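(* For $i\in\{0,1\}$ one has $P_i\otimes V_1\simeq iP_0\oplus(3-i)P_1$ as $\mathfrak{u}(\mathfrak{m})$-modules; that is, $P_0\otimes V_1\simeq 3P_1$ and $P_1\otimes V_1\simeq P_0\oplus 2P_1$.
   Context: $\Bbbk$ is an algebraically closed field of characteristic $2$. $\mathfrak{u}(\mathfrak{m})$ is the unital associative $\Bbbk$-algebra generated by $a,b,c$ with relations $ab+ba=c$, $ac+ca=a$, $bc+cb=b$, $a^4=b^4=0$, $c^2+c=0$; it is a Hopf algebra in which $a,b,c$ are primitive, and tensor products of modules are over $\Bbbk$ with action through the comultiplication. $V_0$ is the trivial one-dimensional module and $V_1$ is the simple module with basis $v_1,v_2,v_3$ and $av_1=v_2$, $av_2=v_3$, $av_3=0$, $bv_1=0$, $bv_2=v_1$, $bv_3=v_2$, $cv_1=v_1$, $cv_2=0$, $cv_3=v_3$. $P_i$ is the projective cover of $V_i$, and $nM$ denotes the direct sum of $n$ copies of $M$. *)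

theory Defs
  imports
    "HOL-Computational_Algebra.Polynomial"
    "HOL-Library.Poly_Mapping"
    "HOL-Library.Product_Plus"
    "HOL-Library.FuncSet"
    "HOL-Algebra.Module"
begin

section \<open>Linear extension\<close>

definition lin_ext :: "('p \<Rightarrow> 'k::zero \<Rightarrow> 'v::comm_monoid_add) \<Rightarrow> ('p \<Rightarrow>\<^sub>0 'k) \<Rightarrow> 'v" where
  "lin_ext \<phi> f = (\<Sum>p\<in>Poly_Mapping.keys f. \<phi> p (Poly_Mapping.lookup f p))"

lemma lin_ext_zero [simp]: "lin_ext \<phi> 0 = 0"
  by (simp add: lin_ext_def)

lemma lin_ext_single: "\<phi> p 0 = 0 \<Longrightarrow> lin_ext \<phi> (Poly_Mapping.single p c) = \<phi> p c"
  by (simp add: lin_ext_def)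

lemma lin_ext_mono:
  assumes "finite S" "Poly_Mapping.keys f \<subseteq> S" "\<And>p. \<phi> p 0 = 0"
  shows "lin_ext \<phi> f = (\<Sum>p\<in>S. \<phi> p (Poly_Mapping.lookup f p))"
  unfolding lin_ext_def
  by (rule sum.mono_neutral_left) (use assms in \<open>auto simp: in_keys_iff\<close>)

lemma lin_ext_add:
  fixes \<phi> :: "'p \<Rightarrow> 'k::monoid_add \<Rightarrow> 'v::comm_monoid_add"
  assumes "\<And>p. \<phi> p 0 = 0" "\<And>p c d. \<phi> p (c + d) = \<phi> p c + \<phi> p d"
  shows "lin_ext \<phi> (f + g) = lin_ext \<phi> f + lin_ext \<phi> g"
proof -
  let ?S = "Poly_Mapping.keys f \<union> Poly_Mapping.keys g"
  have 1: "lin_ext \<phi> (f + g) = (\<Sum>p\<in>?S. \<phi> p (Poly_Mapping.lookup (f + g) p))"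
    by (rule lin_ext_mono) (auto simp: assms keys_add)
  have 2: "lin_ext \<phi> f = (\<Sum>p\<in>?S. \<phi> p (Poly_Mapping.lookup f p))"
    by (rule lin_ext_mono) (auto simp: assms)
  have 3: "lin_ext \<phi> g = (\<Sum>p\<in>?S. \<phi> p (Poly_Mapping.lookup g p))"
    by (rule lin_ext_mono) (auto simp: assms)
  show ?thesis
    unfolding 1 2 3 by (simp add: lookup_add assms(2) sum.distrib)
qed

lemma lin_ext_diff:
  fixes \<phi> :: "'p \<Rightarrow> 'k::ab_group_add \<Rightarrow> 'v::ab_group_add"
  assumes "\<And>p. \<phi> p 0 = 0" "\<And>p c d. \<phi> p (c + d) = \<phi> p c + \<phi> p d"
  shows "lin_ext \<phi> (f - g) = lin_ext \<phi> f - lin_ext \<phi> g"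
proof -
  have "lin_ext \<phi> (f - g + g) = lin_ext \<phi> (f - g) + lin_ext \<phi> g"
    by (rule lin_ext_add) (rule assms)+
  then show ?thesis
    by (simp add: eq_diff_eq)
qed

lemma poly_mapping_keys_induct [consumes 1, case_names zero single add]:
  assumes "Poly_Mapping.keys (f :: 'a \<Rightarrow>\<^sub>0 'b::monoid_add) \<subseteq> S"
  assumes "P 0" "\<And>p c. p \<in> S \<Longrightarrow> P (Poly_Mapping.single p c)"
    "\<And>f g. P f \<Longrightarrow> P g \<Longrightarrow> P (f + g)"
  shows "P f"
  using assms(1)
proof (induction f rule: update_induct)
  case (update f a b)
  have *: "Poly_Mapping.update a b f = Poly_Mapping.single a b + f"
    by (rule poly_mapping_eqI)
      (use update(1) in \<open>auto simp: lookup_update lookup_add lookup_single in_keys_iff when_def\<close>)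
  have "Poly_Mapping.keys f \<subseteq> S" "a \<in> S"
    using update(1,2,4) by (auto simp: in_keys_iff lookup_update split: if_splits)
  then show ?case
    unfolding * using assms(3,4) update(3) by simp
qed (rule assms(2))

lemmas poly_mapping_add_induct =
  poly_mapping_keys_induct[OF subset_UNIV, case_names zero single add]


section \<open>The algebra \<open>u(m)\<close>\<close>

datatype gen = GenA | GenB | GenC

datatype word = Word (letters: "gen list")

instantiation word :: monoid_add
begin

definition zero_word :: word where "0 = Word []"

definition plus_word :: "word \<Rightarrow> word \<Rightarrow> word" where
  "u + v = Word (letters u @ letters v)"

instance
  by standard (simp_all add: zero_word_def plus_word_def)

end

text \<open>
  Concatenation is the monoid operation on words, so the convolution product of
  \<^theory>\<open>HOL-Library.Poly_Mapping\<close> makes \<open>word \<Rightarrow>\<^sub>0 'k\<close> the free unital associative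
  algebra on three generators.
\<close>

type_synonym 'k free = "word \<Rightarrow>\<^sub>0 'k"

definition free_gen :: "gen \<Rightarrow> 'k::field free" where
  "free_gen g = Poly_Mapping.single (Word [g]) 1"

definition um_relations :: "'k::field free set" where
  "um_relations =
    (let a = free_gen GenA; b = free_gen GenB; c = free_gen GenC in
      {a * b + b * a - c, a * c + c * a - a, b * c + c * b - b, a ^ 4, b ^ 4, c ^ 2 + c})"

inductive_set um_ideal :: "'k::field free set" where
  relation: "r \<in> um_relations \<Longrightarrow> r \<in> um_ideal"
| add: "x \<in> um_ideal \<Longrightarrow> y \<in> um_ideal \<Longrightarrow> x + y \<in> um_ideal"
| mult: "x \<in> um_ideal \<Longrightarrow> l * x * r \<in> um_ideal"

lemma um_ideal_zero: "0 \<in> um_ideal"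
proof -
  have "free_gen GenA ^ 4 \<in> um_ideal"
    by (rule um_ideal.relation) (simp add: um_relations_def Let_def)
  from um_ideal.mult[OF this, of 0 0] show ?thesis by simp
qed

lemma um_ideal_minus: "x \<in> um_ideal \<Longrightarrow> - x \<in> um_ideal"
  using um_ideal.mult[of x "-1" 1] by simp

lemma um_ideal_diff: "x \<in> um_ideal \<Longrightarrow> y \<in> um_ideal \<Longrightarrow> x - y \<in> um_ideal"
  using um_ideal.add[of x "- y"] um_ideal_minus[of y] by simp

lemma um_ideal_left: "x \<in> um_ideal \<Longrightarrow> l * x \<in> um_ideal"
  using um_ideal.mult[of x l 1] by simp

lemma um_ideal_right: "x \<in> um_ideal \<Longrightarrow> x * r \<in> um_ideal"
  using um_ideal.mult[of x 1 r] by simp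

lemma lookup_mult_zero_word:
  "Poly_Mapping.lookup (f * g) (0 :: word) = Poly_Mapping.lookup f 0 * Poly_Mapping.lookup (g :: 'k::field free) 0"
proof (induction f rule: poly_mapping_add_induct)
  case (single p c)
  show ?case
  proof (induction g rule: poly_mapping_add_induct)
    case (single q d)
    have "p + q = 0 \<longleftrightarrow> p = 0 \<and> q = 0"
      by (cases p; cases q) (simp add: plus_word_def zero_word_def)
    then show ?case
      by (auto simp: mult_single lookup_single when_def)
  qed (simp_all add: distrib_left lookup_add)
qed (simp_all add: distrib_right lookup_add)

lemma um_ideal_lookup_zero: "x \<in> um_ideal \<Longrightarrow> Poly_Mapping.lookup x 0 = 0"
proof (induction rule: um_ideal.induct)
  case (relation r)
  have "Poly_Mapping.lookup (free_gen g :: 'a free) 0 = 0" for g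
    by (simp add: free_gen_def lookup_single zero_word_def)
  with relation show ?case
    by (auto simp: um_relations_def Let_def lookup_add lookup_minus lookup_mult_zero_word
        power2_eq_square power4_eq_xxxx)
qed (simp_all add: lookup_add lookup_mult_zero_word)

quotient_type (overloaded) 'k um = "'k::field free" / "\<lambda>x y. x - y \<in> um_ideal"
  morphisms rep_um abs_um
proof (rule equivpI)
  show "reflp (\<lambda>x y :: 'k free. x - y \<in> um_ideal)"
    by (simp add: reflp_def um_ideal_zero)
  show "symp (\<lambda>x y :: 'k free. x - y \<in> um_ideal)"
  proof (rule sympI)
    fix x y :: "'k free"
    assume "x - y \<in> um_ideal"
    from um_ideal_minus[OF this] show "y - x \<in> um_ideal" by simp
  qed
  show "transp (\<lambda>x y :: 'k free. x - y \<in> um_ideal)"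
  proof (rule transpI)
    fix x y z :: "'k free"
    assume "x - y \<in> um_ideal" "y - z \<in> um_ideal"
    from um_ideal.add[OF this] show "x - z \<in> um_ideal" by simp
  qed
qed

instantiation um :: (field) ring_1
begin

lift_definition zero_um :: "'a um" is 0 .
lift_definition one_um :: "'a um" is 1 .

lift_definition plus_um :: "'a um \<Rightarrow> 'a um \<Rightarrow> 'a um" is "(+)"
proof -
  fix x y z w :: "'a free"
  assume "x - y \<in> um_ideal" "z - w \<in> um_ideal"
  then have "(x - y) + (z - w) \<in> um_ideal" by (rule um_ideal.add)
  then show "x + z - (y + w) \<in> um_ideal" by (simp add: algebra_simps)
qed

lift_definition minus_um :: "'a um \<Rightarrow> 'a um \<Rightarrow> 'a um" is "(-)"
proof -
  fix x y z w :: "'a free"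
  assume "x - y \<in> um_ideal" "z - w \<in> um_ideal"
  then have "(x - y) - (z - w) \<in> um_ideal" by (rule um_ideal_diff)
  then show "x - z - (y - w) \<in> um_ideal" by (simp add: algebra_simps)
qed

lift_definition uminus_um :: "'a um \<Rightarrow> 'a um" is uminus
proof -
  fix x y :: "'a free"
  assume "x - y \<in> um_ideal"
  then have "- (x - y) \<in> um_ideal" by (rule um_ideal_minus)
  then show "- x - - y \<in> um_ideal" by simp
qed

lift_definition times_um :: "'a um \<Rightarrow> 'a um \<Rightarrow> 'a um" is "(*)"
proof -
  fix x y z w :: "'a free"
  assume "x - y \<in> um_ideal" "z - w \<in> um_ideal"
  then have "(x - y) * z + y * (z - w) \<in> um_ideal"
    by (intro um_ideal.add um_ideal_left um_ideal_right)
  then show "x * z - y * w \<in> um_ideal" by (simp add: algebra_simps)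
qed

instance
proof
  fix x y z :: "'a um"
  show "x * y * z = x * (y * z)"
    by transfer (simp add: mult.assoc um_ideal_zero)
  show "x + y + z = x + (y + z)"
    by transfer (simp add: add.assoc um_ideal_zero)
  show "x + y = y + x"
    by transfer (simp add: add.commute um_ideal_zero)
  show "0 + x = x" "- x + x = 0" "x - y = x + - y" "1 * x = x" "x * 1 = x"
    by (transfer, simp add: um_ideal_zero)+
  show "(x + y) * z = x * z + y * z"
    by transfer (simp add: distrib_right um_ideal_zero)
  show "x * (y + z) = x * y + x * z"
    by transfer (simp add: distrib_left um_ideal_zero)
  show "(0 :: 'a um) \<noteq> 1"
  proof (transfer, rule notI)
    assume "0 - 1 \<in> (um_ideal :: 'a free set)"
    from um_ideal_lookup_zero[OF this] show False
      by (simp add: lookup_minus lookup_one)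
  qed
qed

end

definition um_gen :: "gen \<Rightarrow> 'k::field um" where
  "um_gen g = abs_um (free_gen g)"

definition um_scalar :: "'k::field \<Rightarrow> 'k um" where
  "um_scalar c = abs_um (Poly_Mapping.single 0 c)"

lemma um_scalar_add: "um_scalar (c + d) = um_scalar c + um_scalar d"
  by (simp add: um_scalar_def plus_um.abs_eq single_add)

lemma um_scalar_mult: "um_scalar (c * d) = um_scalar c * um_scalar d"
  by (simp add: um_scalar_def times_um.abs_eq mult_single)

lemma um_scalar_one: "um_scalar 1 = 1"
  by (simp add: um_scalar_def one_um_def)

lemma um_scalar_central: "um_scalar c * x = x * um_scalar c"
proof -
  obtain f where x: "x = abs_um f"
    using Quotient_abs_rep[OF Quotient_um] by metis
  have "Poly_Mapping.single 0 c * f = f * Poly_Mapping.single 0 c"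
    by (induction f rule: poly_mapping_add_induct)
      (simp_all add: mult_single mult.commute[of c] distrib_left distrib_right)
  then show ?thesis
    by (simp add: x um_scalar_def times_um.abs_eq)
qed


section \<open>Modules\<close>

text \<open>
  Left modules over a possibly noncommutative ring; as in the locale \<^locale>\<open>module\<close>, the
  fields \<^term>\<open>mult\<close> and \<^term>\<open>one\<close> of the record play no role.
\<close>

locale left_module = abelian_group M for M :: "('r::ring_1, 'v) module" (structure) +
  assumes smult_closed: "x \<in> carrier M \<Longrightarrow> r \<odot> x \<in> carrier M"
    and smult_l_distr: "x \<in> carrier M \<Longrightarrow> (r + s) \<odot> x = r \<odot> x \<oplus> s \<odot> x"
    and smult_r_distr: "x \<in> carrier M \<Longrightarrow> y \<in> carrier M \<Longrightarrow> r \<odot> (x \<oplus> y) = r \<odot> x \<oplus> r \<odot> y"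
    and smult_assoc: "x \<in> carrier M \<Longrightarrow> (r * s) \<odot> x = r \<odot> (s \<odot> x)"
    and smult_one: "x \<in> carrier M \<Longrightarrow> 1 \<odot> x = x"

definition mod_hom :: "('r, 'v) module \<Rightarrow> ('r, 'w) module \<Rightarrow> ('v \<Rightarrow> 'w) set" where
  "mod_hom M N = {h \<in> carrier M \<rightarrow> carrier N.
     (\<forall>x\<in>carrier M. \<forall>y\<in>carrier M. h (x \<oplus>\<^bsub>M\<^esub> y) = h x \<oplus>\<^bsub>N\<^esub> h y) \<and>
     (\<forall>r. \<forall>x\<in>carrier M. h (r \<odot>\<^bsub>M\<^esub> x) = r \<odot>\<^bsub>N\<^esub> h x)}"

definition mod_iso :: "('r, 'v) module \<Rightarrow> ('r, 'w) module \<Rightarrow> bool" (infix "\<simeq>" 50) where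
  "M \<simeq> N \<longleftrightarrow> (\<exists>h\<in>mod_hom M N. bij_betw h (carrier M) (carrier N))"

definition left_submodule :: "'v set \<Rightarrow> ('r, 'v) module \<Rightarrow> bool" where
  "left_submodule U M \<longleftrightarrow> U \<subseteq> carrier M \<and> \<zero>\<^bsub>M\<^esub> \<in> U \<and>
     (\<forall>x\<in>U. \<forall>y\<in>U. x \<oplus>\<^bsub>M\<^esub> y \<in> U) \<and> (\<forall>r. \<forall>x\<in>U. r \<odot>\<^bsub>M\<^esub> x \<in> U)"

definition direct_sum :: "('r, 'v) module \<Rightarrow> ('r, 'w) module \<Rightarrow> ('r, 'v \<times> 'w) module"
    (infixr "\<oplus>\<^sub>d" 65) where
  "M \<oplus>\<^sub>d N = \<lparr>carrier = carrier M \<times> carrier N, mult = undefined, one = undefined,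
     zero = (\<zero>\<^bsub>M\<^esub>, \<zero>\<^bsub>N\<^esub>),
     add = (\<lambda>(x, y) (x', y'). (x \<oplus>\<^bsub>M\<^esub> x', y \<oplus>\<^bsub>N\<^esub> y')),
     smult = (\<lambda>r (x, y). (r \<odot>\<^bsub>M\<^esub> x, r \<odot>\<^bsub>N\<^esub> y))\<rparr>"

definition copies :: "nat \<Rightarrow> ('r, 'v) module \<Rightarrow> ('r, nat \<Rightarrow> 'v) module" where
  "copies n M = \<lparr>carrier = {..<n} \<rightarrow>\<^sub>E carrier M, mult = undefined, one = undefined,
     zero = (\<lambda>i\<in>{..<n}. \<zero>\<^bsub>M\<^esub>),
     add = (\<lambda>x y. \<lambda>i\<in>{..<n}. x i \<oplus>\<^bsub>M\<^esub> y i),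
     smult = (\<lambda>r x. \<lambda>i\<in>{..<n}. r \<odot>\<^bsub>M\<^esub> x i)\<rparr>"

text \<open>
  HOL cannot quantify over types inside a definition, so the lifting property is tested on
  the modules whose carrier is a subset of \<open>'v \<Rightarrow>\<^sub>0 'k um\<close>, where \<open>'v\<close> is the type of the
  elements of \<open>P\<close>. This is no restriction: the universe contains the free module on the
  elements of \<open>P\<close> and a copy of \<open>P\<close>, so the canonical surjection of the one onto the
  other splits, \<open>P\<close> is a direct summand of a free module, and the lifting property holds
  for modules over every type.
\<close>

definition projective :: "('k::field um, 'v) module \<Rightarrow> bool" where
  "projective P \<longleftrightarrow> left_module P \<and>
     (\<forall>(M :: ('k um, 'v \<Rightarrow>\<^sub>0 'k um) module) (N :: ('k um, 'v \<Rightarrow>\<^sub>0 'k um) module) g f.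
        left_module M \<and> left_module N \<and> g \<in> mod_hom M N \<and> g ` carrier M = carrier N \<and>
        f \<in> mod_hom P N \<longrightarrow>
        (\<exists>h\<in>mod_hom P M. \<forall>x\<in>carrier P. g (h x) = f x))"

definition superfluous :: "'v set \<Rightarrow> ('r, 'v) module \<Rightarrow> bool" where
  "superfluous K M \<longleftrightarrow> left_submodule K M \<and>
     (\<forall>U. left_submodule U M \<and> {u \<oplus>\<^bsub>M\<^esub> x | u x. u \<in> U \<and> x \<in> K} = carrier M \<longrightarrow> U = carrier M)"

definition projective_cover :: "('k::field um, 'p) module \<Rightarrow> ('k um, 'v) module \<Rightarrow> bool" where
  "projective_cover P V \<longleftrightarrow> projective P \<and>
     (\<exists>\<pi>\<in>mod_hom P V. \<pi> ` carrier P = carrier V \<and>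
        superfluous {x \<in> carrier P. \<pi> x = \<zero>\<^bsub>V\<^esub>} P)"


section \<open>Tensor products over the ground field\<close>

inductive_set tensor_null ::
    "('k::field um, 'v) module \<Rightarrow> ('k um, 'w) module \<Rightarrow> (('v \<times> 'w) \<Rightarrow>\<^sub>0 'k) set"
  for M N where
  add_left: "m \<in> carrier M \<Longrightarrow> m' \<in> carrier M \<Longrightarrow> n \<in> carrier N \<Longrightarrow>
    Poly_Mapping.single (m \<oplus>\<^bsub>M\<^esub> m', n) c
      - Poly_Mapping.single (m, n) c - Poly_Mapping.single (m', n) c \<in> tensor_null M N"
| add_right: "m \<in> carrier M \<Longrightarrow> n \<in> carrier N \<Longrightarrow> n' \<in> carrier N \<Longrightarrow>
    Poly_Mapping.single (m, n \<oplus>\<^bsub>N\<^esub> n') c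
      - Poly_Mapping.single (m, n) c - Poly_Mapping.single (m, n') c \<in> tensor_null M N"
| scale_left: "m \<in> carrier M \<Longrightarrow> n \<in> carrier N \<Longrightarrow>
    Poly_Mapping.single (um_scalar d \<odot>\<^bsub>M\<^esub> m, n) c
      - Poly_Mapping.single (m, n) (d * c) \<in> tensor_null M N"
| scale_right: "m \<in> carrier M \<Longrightarrow> n \<in> carrier N \<Longrightarrow>
    Poly_Mapping.single (m, um_scalar d \<odot>\<^bsub>N\<^esub> n) c
      - Poly_Mapping.single (m, n) (d * c) \<in> tensor_null M N"
| zero: "0 \<in> tensor_null M N"
| diff: "f \<in> tensor_null M N \<Longrightarrow> g \<in> tensor_null M N \<Longrightarrow> f - g \<in> tensor_null M N"

definition tensor_class ::
    "('k::field um, 'v) module \<Rightarrow> ('k um, 'w) module \<Rightarrow> (('v \<times> 'w) \<Rightarrow>\<^sub>0 'k)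
      \<Rightarrow> (('v \<times> 'w) \<Rightarrow>\<^sub>0 'k) set" where
  "tensor_class M N f = {g. g - f \<in> tensor_null M N}"

text \<open>The bilinear extension of \<open>(x \<otimes> y) (m \<otimes> n) = x m \<otimes> y n\<close>, on representatives.\<close>

definition tensor_act ::
    "('k::field um, 'v) module \<Rightarrow> ('k um, 'w) module \<Rightarrow> (('k um \<times> 'k um) \<Rightarrow>\<^sub>0 'k)
      \<Rightarrow> (('v \<times> 'w) \<Rightarrow>\<^sub>0 'k) \<Rightarrow> (('v \<times> 'w) \<Rightarrow>\<^sub>0 'k)" where
  "tensor_act M N F f =
     lin_ext (\<lambda>(x, y) c. lin_ext (\<lambda>(m, n) d. Poly_Mapping.single (x \<odot>\<^bsub>M\<^esub> m, y \<odot>\<^bsub>N\<^esub> n) (c * d)) f) F"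

lemma tensor_null_minus: "f \<in> tensor_null M N \<Longrightarrow> - f \<in> tensor_null M N"
  using tensor_null.diff[OF tensor_null.zero, of f M N] by simp

lemma tensor_null_add: "f \<in> tensor_null M N \<Longrightarrow> g \<in> tensor_null M N \<Longrightarrow> f + g \<in> tensor_null M N"
  using tensor_null.diff[of f M N "- g"] tensor_null_minus[of g M N] by simp

lemma tensor_act_zero_left [simp]: "tensor_act M N 0 f = 0"
  by (simp add: tensor_act_def)

lemma tensor_act_single_left:
  "tensor_act M N (Poly_Mapping.single (x, y) c) f =
    lin_ext (\<lambda>(m, n) d. Poly_Mapping.single (x \<odot>\<^bsub>M\<^esub> m, y \<odot>\<^bsub>N\<^esub> n) (c * d)) f"
  unfolding tensor_act_def by (subst lin_ext_single) (auto simp: lin_ext_def)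

lemma tensor_act_single:
  "tensor_act M N (Poly_Mapping.single (x, y) c) (Poly_Mapping.single (m, n) d) =
    Poly_Mapping.single (x \<odot>\<^bsub>M\<^esub> m, y \<odot>\<^bsub>N\<^esub> n) (c * d)"
  unfolding tensor_act_single_left by (subst lin_ext_single) auto

lemma tensor_act_add_left: "tensor_act M N (F + G) f = tensor_act M N F f + tensor_act M N G f"
  unfolding tensor_act_def
  by (rule lin_ext_add)
    (auto simp: lin_ext_def distrib_right single_add sum.distrib case_prod_unfold)

lemma tensor_act_diff_left: "tensor_act M N (F - G) f = tensor_act M N F f - tensor_act M N G f"
  using tensor_act_add_left[of M N "F - G" G f] by (simp add: eq_diff_eq)

lemma tensor_act_add_right: "tensor_act M N F (f + g) = tensor_act M N F f + tensor_act M N F g"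
proof (induction F rule: poly_mapping_add_induct)
  case (single p c)
  obtain x y where "p = (x, y)" by force
  then show ?case
    unfolding tensor_act_single_left
    by (simp add: tensor_act_single_left)
      (rule lin_ext_add, auto simp: distrib_left single_add split: prod.split)
qed (simp_all add: tensor_act_add_left algebra_simps)

lemma tensor_act_zero_right [simp]: "tensor_act M N F 0 = 0"
  using tensor_act_add_right[of M N F 0 0] by simp

lemma tensor_act_diff_right: "tensor_act M N F (f - g) = tensor_act M N F f - tensor_act M N F g"
  using tensor_act_add_right[of M N F "f - g" g] by (simp add: eq_diff_eq)

lemma keys_tensor_act:
  assumes "left_module M" "left_module N" "Poly_Mapping.keys f \<subseteq> carrier M \<times> carrier N"
  shows "Poly_Mapping.keys (tensor_act M N F f) \<subseteq> carrier M \<times> carrier N"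
proof (induction F rule: poly_mapping_add_induct)
  case (single p c)
  obtain x y where p: "p = (x, y)" by force
  from assms(3) show ?case
  proof (induction f rule: poly_mapping_keys_induct)
    case (single q d)
    then show ?case
      using assms(1,2)
      by (auto simp: p tensor_act_single left_module.smult_closed split: if_splits)
  next
    case (add f g)
    then show ?case
      unfolding tensor_act_add_right using keys_add by (meson Un_least subset_trans)
  qed simp
next
  case (add F G)
  then show ?case
    unfolding tensor_act_add_left using keys_add by (meson Un_least subset_trans)
qed simp

lemma tensor_act_null_right:
  assumes M: "left_module M" and N: "left_module N" and f: "f \<in> tensor_null M N"
  shows "tensor_act M N F f \<in> tensor_null M N"
proof (induction F rule: poly_mapping_add_induct)
  case (single p c)
  obtain x y where p: "p = (x, y)" by force
  note simps = p tensor_act_diff_right tensor_act_single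
    left_module.smult_r_distr[OF M] left_module.smult_r_distr[OF N]
    left_module.smult_assoc[OF M, symmetric] left_module.smult_assoc[OF N, symmetric]
    um_scalar_central[symmetric]
  note closed = left_module.smult_closed[OF M] left_module.smult_closed[OF N]
  from f show ?case
  proof (induction rule: tensor_null.induct)
    case (add_left m m' n d)
    then show ?case
      unfolding p tensor_act_diff_right tensor_act_single left_module.smult_r_distr[OF M add_left(1,2)]
      by (intro tensor_null.add_left closed)
  next
    case (add_right m n n' d)
    then show ?case
      unfolding p tensor_act_diff_right tensor_act_single left_module.smult_r_distr[OF N add_right(2,3)]
      by (intro tensor_null.add_right closed)
  next
    case (scale_left m n d e)
    have "x \<odot>\<^bsub>M\<^esub> (um_scalar d \<odot>\<^bsub>M\<^esub> m) = um_scalar d \<odot>\<^bsub>M\<^esub> (x \<odot>\<^bsub>M\<^esub> m)"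
      using scale_left left_module.smult_assoc[OF M] by (metis um_scalar_central)
    then show ?case
      unfolding p tensor_act_diff_right tensor_act_single
      using tensor_null.scale_left[OF closed(1)[OF scale_left(1)] closed(2)[OF scale_left(2)], where d = d and c = "c * e"]
      by (simp add: mult.left_commute)
  next
    case (scale_right m n d e)
    have "y \<odot>\<^bsub>N\<^esub> (um_scalar d \<odot>\<^bsub>N\<^esub> n) = um_scalar d \<odot>\<^bsub>N\<^esub> (y \<odot>\<^bsub>N\<^esub> n)"
      using scale_right left_module.smult_assoc[OF N] by (metis um_scalar_central)
    then show ?case
      unfolding p tensor_act_diff_right tensor_act_single
      using tensor_null.scale_right[OF closed(1)[OF scale_right(1)] closed(2)[OF scale_right(2)], where d = d and c = "c * e"]
      by (simp add: mult.left_commute)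
  qed (simp_all add: tensor_null.zero tensor_act_diff_right tensor_null.diff)
qed (simp_all add: tensor_null.zero tensor_act_add_left tensor_null_add)

definition regular :: "('r::ring_1, 'r) module" where
  "regular = \<lparr>carrier = UNIV, mult = undefined, one = undefined, zero = 0, add = (+), smult = (*)\<rparr>"

lemma regular_simps [simp]:
  "carrier regular = UNIV" "zero regular = 0" "add regular = (+)" "smult regular = (*)"
  by (simp_all add: regular_def)

lemma left_module_regular: "left_module regular"
proof (intro left_module.intro left_module_axioms.intro)
  show "abelian_group (regular :: ('a, 'a) module)"
    by (rule abelian_groupI) (auto simp: algebra_simps intro: exI[of _ "- x" for x])
qed (simp_all add: algebra_simps)

lemma tensor_act_null_left:
  assumes M: "left_module M" and N: "left_module N" and F: "F \<in> tensor_null regular regular"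
    and f: "Poly_Mapping.keys f \<subseteq> carrier M \<times> carrier N"
  shows "tensor_act M N F f \<in> tensor_null M N"
  using f
proof (induction f rule: poly_mapping_keys_induct)
  case (single q e)
  then obtain m n where q: "q = (m, n)" and m: "m \<in> carrier M" and n: "n \<in> carrier N" by auto
  note closed = left_module.smult_closed[OF M m] left_module.smult_closed[OF N n]
  note assoc = left_module.smult_assoc[OF M m] left_module.smult_assoc[OF N n]
  note distr = left_module.smult_l_distr[OF M m] left_module.smult_l_distr[OF N n]
  from F show ?case
  proof (induction rule: tensor_null.induct)
    case (add_left x x' y c)
    show ?case
      unfolding q tensor_act_diff_left tensor_act_single regular_simps distr
      by (intro tensor_null.add_left closed)
  next
    case (add_right x y y' c)
    show ?case
      unfolding q tensor_act_diff_left tensor_act_single regular_simps distr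
      by (intro tensor_null.add_right closed)
  next
    case (scale_left x y d c)
    show ?case
      unfolding q tensor_act_diff_left tensor_act_single regular_simps assoc mult.assoc
      by (intro tensor_null.scale_left closed)
  next
    case (scale_right x y d c)
    show ?case
      unfolding q tensor_act_diff_left tensor_act_single regular_simps assoc mult.assoc
      by (intro tensor_null.scale_right closed)
  qed (simp_all add: tensor_null.zero tensor_act_diff_left tensor_null.diff)
qed (simp_all add: tensor_null.zero tensor_act_add_right tensor_null_add)

lemma tensor_act_assoc:
  assumes M: "left_module M" and N: "left_module N"
    and f: "Poly_Mapping.keys f \<subseteq> carrier M \<times> carrier N"
  shows "tensor_act M N (tensor_act regular regular F G) f = tensor_act M N F (tensor_act M N G f)"
proof (induction F rule: poly_mapping_add_induct)
  case (single p c)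
  obtain x y where p: "p = (x, y)" by force
  show ?case
  proof (induction G rule: poly_mapping_add_induct)
    case (single q d)
    obtain x' y' where q: "q = (x', y')" by force
    from f show ?case
    proof (induction f rule: poly_mapping_keys_induct)
      case (single r e)
      then show ?case
        by (auto simp: p q tensor_act_single mult.assoc
            left_module.smult_assoc[OF M] left_module.smult_assoc[OF N])
    qed (simp_all add: tensor_act_add_right)
  qed (simp_all add: tensor_act_add_left tensor_act_add_right)
qed (simp_all add: tensor_act_add_left)


section \<open>The Hopf algebra structure\<close>

text \<open>The algebra \<open>u(m) \<otimes> u(m)\<close>, with product \<open>(x \<otimes> y) (x' \<otimes> y') = x x' \<otimes> y y'\<close>.\<close>

quotient_type (overloaded) 'k um2 =
    "('k::field um \<times> 'k um) \<Rightarrow>\<^sub>0 'k" / "\<lambda>F G. F - G \<in> tensor_null regular regular"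
  morphisms rep_um2 abs_um2
proof (rule equivpI)
  let ?T = "tensor_null regular regular :: (('k um \<times> 'k um) \<Rightarrow>\<^sub>0 'k) set"
  show "reflp (\<lambda>F G. F - G \<in> ?T)"
    by (simp add: reflp_def tensor_null.zero)
  show "symp (\<lambda>F G. F - G \<in> ?T)"
  proof (rule sympI)
    fix F G
    assume "F - G \<in> ?T"
    from tensor_null_minus[OF this] show "G - F \<in> ?T" by simp
  qed
  show "transp (\<lambda>F G. F - G \<in> ?T)"
  proof (rule transpI)
    fix F G H
    assume "F - G \<in> ?T" "G - H \<in> ?T"
    from tensor_null_add[OF this] show "F - H \<in> ?T" by simp
  qed
qed

instantiation um2 :: (field) "{ring, monoid_mult}"
begin

lift_definition zero_um2 :: "'a um2" is 0 .
lift_definition one_um2 :: "'a um2" is "Poly_Mapping.single (1, 1) 1" .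

lift_definition plus_um2 :: "'a um2 \<Rightarrow> 'a um2 \<Rightarrow> 'a um2" is "(+)"
  by (metis add_diff_add tensor_null_add)

lift_definition minus_um2 :: "'a um2 \<Rightarrow> 'a um2 \<Rightarrow> 'a um2" is "(-)"
proof -
  fix x y z w :: "('a um \<times> 'a um) \<Rightarrow>\<^sub>0 'a"
  assume "x - y \<in> tensor_null regular regular" "z - w \<in> tensor_null regular regular"
  then have "(x - y) - (z - w) \<in> tensor_null regular regular" by (rule tensor_null.diff)
  then show "x - z - (y - w) \<in> tensor_null regular regular" by (simp add: algebra_simps)
qed

lift_definition uminus_um2 :: "'a um2 \<Rightarrow> 'a um2" is uminus
proof -
  fix x y :: "('a um \<times> 'a um) \<Rightarrow>\<^sub>0 'a"
  assume "x - y \<in> tensor_null regular regular"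
  from tensor_null_minus[OF this] show "- x - - y \<in> tensor_null regular regular" by simp
qed

lift_definition times_um2 :: "'a um2 \<Rightarrow> 'a um2 \<Rightarrow> 'a um2" is "tensor_act regular regular"
proof -
  fix x y z w :: "('a um \<times> 'a um) \<Rightarrow>\<^sub>0 'a"
  assume "x - y \<in> tensor_null regular regular" "z - w \<in> tensor_null regular regular"
  then have "tensor_act regular regular (x - y) z + tensor_act regular regular y (z - w)
      \<in> tensor_null regular regular"
    by (intro tensor_null_add tensor_act_null_left tensor_act_null_right left_module_regular) auto
  then show "tensor_act regular regular x z - tensor_act regular regular y w
      \<in> tensor_null regular regular"
    by (simp add: tensor_act_diff_left tensor_act_diff_right)
qed

lemma tensor_act_one_left:
  assumes M: "left_module M" and N: "left_module N"
    and f: "Poly_Mapping.keys f \<subseteq> carrier M \<times> carrier N"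
  shows "tensor_act M N (Poly_Mapping.single (1, 1) 1) f = f"
  using f
  by (induction f rule: poly_mapping_keys_induct)
    (auto simp: tensor_act_single tensor_act_add_right left_module.smult_one[OF M]
      left_module.smult_one[OF N])

lemma tensor_act_one_right:
  "tensor_act regular regular F (Poly_Mapping.single (1, 1) 1) = F"
proof (induction F rule: poly_mapping_add_induct)
  case (single p c)
  then show ?case by (cases p) (simp add: tensor_act_single)
qed (simp_all add: tensor_act_add_left)

instance
proof
  fix x y z :: "'a um2"
  show "x * y * z = x * (y * z)"
    by transfer (simp add: tensor_act_assoc[OF left_module_regular left_module_regular] tensor_null.zero)
  show "x + y + z = x + (y + z)"
    by transfer (simp add: add.assoc tensor_null.zero)
  show "x + y = y + x"
    by transfer (simp add: add.commute tensor_null.zero)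
  show "0 + x = x" "- x + x = 0" "x - y = x + - y"
    by (transfer, simp add: tensor_null.zero)+
  show "1 * x = x"
    by transfer (simp add: tensor_act_one_left[OF left_module_regular left_module_regular] tensor_null.zero)
  show "x * 1 = x"
    by transfer (simp add: tensor_act_one_right tensor_null.zero)
  show "(x + y) * z = x * z + y * z"
    by transfer (simp add: tensor_act_add_left tensor_null.zero)
  show "x * (y + z) = x * y + x * z"
    by transfer (simp add: tensor_act_add_right tensor_null.zero)
qed

end

definition um2_pure :: "'k::field um \<Rightarrow> 'k um \<Rightarrow> 'k um2" (infix "\<otimes>\<^sub>u" 75) where
  "x \<otimes>\<^sub>u y = abs_um2 (Poly_Mapping.single (x, y) 1)"

definition um2_scalar :: "'k::field \<Rightarrow> 'k um2" where
  "um2_scalar c = abs_um2 (Poly_Mapping.single (1, 1) c)"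

definition comult_free :: "'k::field free \<Rightarrow> 'k um2" where
  "comult_free =
    lin_ext (\<lambda>w c. um2_scalar c
      * prod_list (map (\<lambda>g. um_gen g \<otimes>\<^sub>u 1 + 1 \<otimes>\<^sub>u um_gen g) (letters w)))"

text \<open>
  The algebra homomorphism \<open>u(m) \<rightarrow> u(m) \<otimes> u(m)\<close> for which the generators are primitive. It is
  independent of the representative only in characteristic 2, see \<open>comult_hom\<close> and
  \<open>comult_primitive\<close> below.
\<close>

definition comult :: "'k::field um \<Rightarrow> 'k um2" where
  "comult x = comult_free (rep_um x)"

lemma um2_pure_add_left: "(x + y) \<otimes>\<^sub>u z = x \<otimes>\<^sub>u z + y \<otimes>\<^sub>u z"
proof -
  have "Poly_Mapping.single (x + y, z) 1 - Poly_Mapping.single (x, z) 1 - Poly_Mapping.single (y, z) 1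
      \<in> tensor_null (regular :: ('a um, 'a um) module) regular"
    using tensor_null.add_left[of x regular y z regular 1] by simp
  then show ?thesis
    by (simp add: um2_pure_def plus_um2.abs_eq um2.abs_eq_iff diff_diff_eq)
qed

lemma um2_pure_add_right: "x \<otimes>\<^sub>u (y + z) = x \<otimes>\<^sub>u y + x \<otimes>\<^sub>u z"
proof -
  have "Poly_Mapping.single (x, y + z) 1 - Poly_Mapping.single (x, y) 1 - Poly_Mapping.single (x, z) 1
      \<in> tensor_null (regular :: ('a um, 'a um) module) regular"
    using tensor_null.add_right[of x regular y regular z 1] by simp
  then show ?thesis
    by (simp add: um2_pure_def plus_um2.abs_eq um2.abs_eq_iff diff_diff_eq)
qed

lemma um2_pure_mult: "(x \<otimes>\<^sub>u y) * (x' \<otimes>\<^sub>u y') = (x * x') \<otimes>\<^sub>u (y * y')"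
  by (simp add: um2_pure_def times_um2.abs_eq tensor_act_single)

lemma um2_pure_one: "1 \<otimes>\<^sub>u 1 = 1"
  by (simp add: um2_pure_def one_um2_def)

lemma um2_pure_zero: "0 \<otimes>\<^sub>u x = 0" "x \<otimes>\<^sub>u 0 = 0"
  using um2_pure_add_left[of 0 0 x] um2_pure_add_right[of x 0 0] by simp_all

lemma um2_scalar_zero: "um2_scalar 0 = 0"
  by (simp add: um2_scalar_def zero_um2_def)

lemma um2_scalar_one: "um2_scalar 1 = 1"
  by (simp add: um2_scalar_def one_um2_def)

lemma um2_scalar_add: "um2_scalar (c + d) = um2_scalar c + um2_scalar d"
  by (simp add: um2_scalar_def plus_um2.abs_eq single_add)

lemma um2_scalar_mult: "um2_scalar (c * d) = um2_scalar c * um2_scalar d"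
  by (simp add: um2_scalar_def times_um2.abs_eq tensor_act_single)

lemma um2_scalar_central: "um2_scalar c * x = x * um2_scalar c"
proof -
  obtain F where x: "x = abs_um2 F"
    using Quotient_abs_rep[OF Quotient_um2] by metis
  have "tensor_act regular regular (Poly_Mapping.single (1, 1) c) F =
      tensor_act regular regular F (Poly_Mapping.single (1, 1) c)"
  proof (induction F rule: poly_mapping_add_induct)
    case (single p d)
    then show ?case by (cases p) (simp add: tensor_act_single mult.commute)
  qed (simp_all add: tensor_act_add_left tensor_act_add_right)
  then show ?thesis
    by (simp add: x um2_scalar_def times_um2.abs_eq)
qed

lemma comult_free_add: "comult_free (f + g) = comult_free f + comult_free g"
  unfolding comult_free_def
  by (rule lin_ext_add) (simp_all add: um2_scalar_zero um2_scalar_add distrib_right)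

lemma comult_free_zero [simp]: "comult_free 0 = 0"
  by (simp add: comult_free_def)

lemma comult_free_minus: "comult_free (- f) = - comult_free f"
  using comult_free_add[of f "- f"] by (simp add: eq_neg_iff_add_eq_0 add.commute)

lemma comult_free_diff: "comult_free (f - g) = comult_free f - comult_free g"
  using comult_free_add[of f "- g"] by (simp add: comult_free_minus)

lemma comult_free_single:
  "comult_free (Poly_Mapping.single w c) = um2_scalar c
    * prod_list (map (\<lambda>g. um_gen g \<otimes>\<^sub>u 1 + 1 \<otimes>\<^sub>u um_gen g) (letters w))"
  unfolding comult_free_def by (rule lin_ext_single) (simp add: um2_scalar_zero)

lemma comult_free_mult: "comult_free (f * g) = comult_free f * comult_free g"
proof (induction f rule: poly_mapping_add_induct)
  case (single u c)
  show ?case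
  proof (induction g rule: poly_mapping_add_induct)
    case (single v d)
    have "um2_scalar (c * d) * (X * Y) = (um2_scalar c * X) * (um2_scalar d * Y)" for X Y :: "'a um2"
      by (metis um2_scalar_central um2_scalar_mult mult.assoc)
    then show ?case
      by (simp add: mult_single comult_free_single plus_word_def)
  qed (simp_all add: distrib_left comult_free_add)
qed (simp_all add: distrib_right comult_free_add)

lemma comult_free_gen: "comult_free (free_gen g) = um_gen g \<otimes>\<^sub>u 1 + 1 \<otimes>\<^sub>u um_gen g"
  by (simp add: free_gen_def comult_free_single um2_scalar_one)

lemma comult_free_one: "comult_free 1 = 1"
proof -
  have "comult_free (Poly_Mapping.single 0 1) = (1 :: 'a um2)"
    unfolding comult_free_single by (simp add: zero_word_def um2_scalar_one)
  then show ?thesis by simp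
qed

lemma um2_double:
  assumes "CHAR('k::field) = 2"
  shows "(x :: 'k um2) + x = 0"
proof -
  have "(1 :: 'k) + 1 = 0"
    using of_nat_CHAR[where 'a = 'k] assms by simp
  then have "(1 :: 'k um2) + 1 = 0"
    by (metis um2_scalar_add um2_scalar_one um2_scalar_zero)
  then show ?thesis
    by (metis distrib_right mult_1 mult_zero_left)
qed

lemma um_gen_relations:
  fixes a b c :: "'k::field um"
  defines "a \<equiv> um_gen GenA" and "b \<equiv> um_gen GenB" and "c \<equiv> um_gen GenC"
  shows "a * b + b * a = c" "a * c + c * a = a" "b * c + c * b = b" "a ^ 4 = 0" "b ^ 4 = 0" "c ^ 2 + c = 0"
proof -
  have pow: "abs_um f ^ n = abs_um (f ^ n)" for f :: "'k free" and n
    by (induction n) (simp_all add: one_um_def times_um.abs_eq)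
  have rel: "r \<in> um_relations \<Longrightarrow> abs_um r = (0 :: 'k um)" for r
    by (simp add: zero_um_def um.abs_eq_iff um_ideal.relation)
  note simps = um_relations_def Let_def times_um.abs_eq[symmetric] plus_um.abs_eq[symmetric]
    minus_um.abs_eq[symmetric] pow[symmetric] um_gen_def[symmetric] a_def b_def c_def
  show "a * b + b * a = c"
    using rel[of "free_gen GenA * free_gen GenB + free_gen GenB * free_gen GenA - free_gen GenC"]
    by (simp add: simps)
  show "a * c + c * a = a"
    using rel[of "free_gen GenA * free_gen GenC + free_gen GenC * free_gen GenA - free_gen GenA"]
    by (simp add: simps)
  show "b * c + c * b = b"
    using rel[of "free_gen GenB * free_gen GenC + free_gen GenC * free_gen GenB - free_gen GenB"]
    by (simp add: simps)
  show "a ^ 4 = 0" using rel[of "free_gen GenA ^ 4"] by (simp add: simps)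
  show "b ^ 4 = 0" using rel[of "free_gen GenB ^ 4"] by (simp add: simps)
  show "c ^ 2 + c = 0" using rel[of "free_gen GenC ^ 2 + free_gen GenC"] by (simp add: simps)
qed

lemma comult_free_relations:
  assumes char: "CHAR('k::field) = 2" and r: "r \<in> (um_relations :: 'k free set)"
  shows "comult_free r = 0"
proof -
  define L R :: "gen \<Rightarrow> 'k um2" where "L g = um_gen g \<otimes>\<^sub>u 1" and "R g = 1 \<otimes>\<^sub>u um_gen g" for g
  note dbl = um2_double[OF char]
  have dbl': "x + (x + y) = y" for x y :: "'k um2"
    using dbl[of x] by (simp add: add.assoc[symmetric])
  have comm: "R g * L h = L h * R g" for g h
    by (simp add: L_def R_def um2_pure_mult)
  have comm': "R g * (L h * x) = L h * (R g * x)" for g h x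
    by (simp add: mult.assoc[symmetric] comm)
  have gen: "comult_free (free_gen g) = L g + R g" for g
    by (simp add: comult_free_gen L_def R_def)
  note pure = L_def R_def um2_pure_mult um2_pure_add_left[symmetric] um2_pure_add_right[symmetric]
  have bracket: "(L g + R g) * (L h + R h) + (L h + R h) * (L g + R g) =
      (L g * L h + L h * L g) + (R g * R h + R h * R g)" for g h
    by (simp add: distrib_left distrib_right comm add_ac dbl dbl')
  have square: "(L g + R g) * (L g + R g) = L g * L g + R g * R g" for g
    by (simp add: distrib_left distrib_right comm add_ac dbl dbl')
  have four: "(L g * L g + R g * R g) * (L g * L g + R g * R g) =
      L g * L g * (L g * L g) + R g * R g * (R g * R g)" for g
    by (simp add: distrib_left distrib_right comm comm' mult.assoc add_ac dbl dbl')
  note rels = um_gen_relations[where 'k = 'k]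
  have "L GenC * L GenC + L GenC = 0" "R GenC * R GenC + R GenC = 0"
    using rels(6) by (simp_all add: pure power2_eq_square um2_pure_zero)
  then have idem: "L GenC * L GenC + R GenC * R GenC + (L GenC + R GenC) = 0"
    by (metis add.assoc add.commute add.right_neutral)
  have pow4: "x ^ 4 = x * x * (x * x)" for x :: "'x::monoid_mult"
    by (simp add: power4_eq_xxxx mult.assoc)
  show ?thesis
    using r rels
    by (auto simp: um_relations_def Let_def comult_free_add comult_free_diff comult_free_mult
        pow4 power2_eq_square gen bracket square four idem)
      (auto simp: pure um2_pure_zero)
qed

lemma comult_free_ideal:
  assumes "CHAR('k::field) = 2" and "r \<in> (um_ideal :: 'k free set)"
  shows "comult_free r = 0"
  using assms(2)
  by (induction rule: um_ideal.induct)
    (simp_all add: comult_free_relations[OF assms(1)] comult_free_add comult_free_mult)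

lemma comult_abs_um:
  assumes "CHAR('k::field) = 2"
  shows "comult (abs_um f) = comult_free (f :: 'k free)"
proof -
  have "abs_um (rep_um (abs_um f)) = abs_um f"
    by (rule Quotient_abs_rep[OF Quotient_um])
  then have "rep_um (abs_um f) - f \<in> um_ideal"
    by (simp only: um.abs_eq_iff)
  from comult_free_ideal[OF assms this] show ?thesis
    by (simp add: comult_def comult_free_diff)
qed

lemma comult_hom:
  assumes "CHAR('k::field) = 2"
  shows "comult (x + y) = comult x + comult (y :: 'k um)"
    and "comult (x * y) = comult x * comult (y :: 'k um)"
    and "comult (1 :: 'k um) = 1"
    and "comult (um_scalar c) = um2_scalar (c :: 'k)"
proof -
  obtain f g where xy: "x = abs_um f" "y = abs_um g"
    using Quotient_abs_rep[OF Quotient_um] by metis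
  show "comult (x + y) = comult x + comult y"
    by (simp add: xy plus_um.abs_eq comult_abs_um[OF assms] comult_free_add)
  show "comult (x * y) = comult x * comult y"
    by (simp add: xy times_um.abs_eq comult_abs_um[OF assms] comult_free_mult)
  show "comult (1 :: 'k um) = 1"
    by (simp add: one_um_def comult_abs_um[OF assms] comult_free_one)
  show "comult (um_scalar c) = um2_scalar c"
    by (simp add: um_scalar_def comult_abs_um[OF assms] comult_free_single zero_word_def)
qed

lemma comult_primitive:
  assumes "CHAR('k::field) = 2"
  shows "comult (um_gen g :: 'k um) = um_gen g \<otimes>\<^sub>u 1 + 1 \<otimes>\<^sub>u um_gen g"
  by (simp add: um_gen_def comult_abs_um[OF assms] comult_free_gen[unfolded um_gen_def])

definition tensor_module ::
    "('k::field um, 'v) module \<Rightarrow> ('k um, 'w) module \<Rightarrow> ('k um, (('v \<times> 'w) \<Rightarrow>\<^sub>0 'k) set) module"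
    (infixr "\<otimes>\<^sub>m" 70) where
  "M \<otimes>\<^sub>m N = \<lparr>carrier = tensor_class M N ` {f. Poly_Mapping.keys f \<subseteq> carrier M \<times> carrier N},
     mult = undefined, one = undefined,
     zero = tensor_class M N 0,
     add = (\<lambda>S T. \<Union>f\<in>S. \<Union>g\<in>T. tensor_class M N (f + g)),
     smult = (\<lambda>x S. \<Union>f\<in>S. tensor_class M N (tensor_act M N (rep_um2 (comult x)) f))\<rparr>"

lemma tensor_class_eq_iff: "tensor_class M N f = tensor_class M N g \<longleftrightarrow> f - g \<in> tensor_null M N"
proof
  assume "tensor_class M N f = tensor_class M N g"
  moreover have "f \<in> tensor_class M N f" by (simp add: tensor_class_def tensor_null.zero)
  ultimately show "f - g \<in> tensor_null M N" by (simp add: tensor_class_def)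
next
  assume fg: "f - g \<in> tensor_null M N"
  have "h - f \<in> tensor_null M N \<longleftrightarrow> h - g \<in> tensor_null M N" for h
    using tensor_null_add[OF _ fg, of "h - f"] tensor_null.diff[OF _ fg, of "h - g"] by auto
  then show "tensor_class M N f = tensor_class M N g" by (simp add: tensor_class_def)
qed

lemma tensor_class_self: "f \<in> tensor_class M N f"
  by (simp add: tensor_class_def tensor_null.zero)

lemma tensor_module_add:
  "tensor_class M N f \<oplus>\<^bsub>M \<otimes>\<^sub>m N\<^esub> tensor_class M N g = tensor_class M N (f + g)"
proof -
  have "tensor_class M N (f' + g') = tensor_class M N (f + g)"
    if "f' \<in> tensor_class M N f" "g' \<in> tensor_class M N g" for f' g'
    using that tensor_null_add[of "f' - f" M N "g' - g"]
    by (simp add: tensor_class_def[of M N f] tensor_class_def[of M N g] tensor_class_eq_iff add_diff_add)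
  then have "(\<Union>f'\<in>tensor_class M N f. \<Union>g'\<in>tensor_class M N g. tensor_class M N (f' + g')) =
      (\<Union>f'\<in>tensor_class M N f. \<Union>g'\<in>tensor_class M N g. tensor_class M N (f + g))"
    by (intro SUP_cong refl) simp
  then show ?thesis
    using tensor_class_self[of f M N] tensor_class_self[of g M N] by (auto simp: tensor_module_def)
qed

lemma tensor_module_smult:
  assumes M: "left_module M" and N: "left_module N"
    and f: "Poly_Mapping.keys f \<subseteq> carrier M \<times> carrier N" and F: "comult x = abs_um2 F"
  shows "x \<odot>\<^bsub>M \<otimes>\<^sub>m N\<^esub> tensor_class M N f = tensor_class M N (tensor_act M N F f)"
proof -
  let ?G = "rep_um2 (comult x)"
  have G: "?G - F \<in> tensor_null regular regular"
    using Quotient_abs_rep[OF Quotient_um2, of "comult x"] by (simp only: F um2.abs_eq_iff)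
  have "tensor_class M N (tensor_act M N ?G f') = tensor_class M N (tensor_act M N F f)"
    if "f' \<in> tensor_class M N f" for f'
  proof -
    have "tensor_act M N ?G (f' - f) + tensor_act M N (?G - F) f \<in> tensor_null M N"
      using that by (intro tensor_null_add tensor_act_null_right tensor_act_null_left M N G f)
        (simp add: tensor_class_def)
    then show ?thesis
      by (simp add: tensor_class_eq_iff tensor_act_diff_left tensor_act_diff_right)
  qed
  then have "(\<Union>f'\<in>tensor_class M N f. tensor_class M N (tensor_act M N ?G f')) =
      (\<Union>f'\<in>tensor_class M N f. tensor_class M N (tensor_act M N F f))"
    by (intro SUP_cong refl) simp
  then show ?thesis
    using tensor_class_self[of f M N] by (auto simp: tensor_module_def)
qed

lemma left_module_tensor:
  assumes char: "CHAR('k::field) = 2"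
    and M: "left_module (M :: ('k um, 'v) module)" and N: "left_module (N :: ('k um, 'w) module)"
  shows "left_module (M \<otimes>\<^sub>m N)"
proof -
  let ?C = "{f :: ('v \<times> 'w) \<Rightarrow>\<^sub>0 'k. Poly_Mapping.keys f \<subseteq> carrier M \<times> carrier N}"
  let ?t = "tensor_class M N"
  have car: "carrier (M \<otimes>\<^sub>m N) = ?t ` ?C" and zero: "\<zero>\<^bsub>M \<otimes>\<^sub>m N\<^esub> = ?t 0"
    by (simp_all add: tensor_module_def)
  have plus: "f + g \<in> ?C" if "f \<in> ?C" "g \<in> ?C" for f g
    using that keys_add[of f g] by auto
  have minus: "- f \<in> ?C" if "f \<in> ?C" for f
    using that by (auto simp: in_keys_iff subset_iff)
  have act: "tensor_act M N F f \<in> ?C" if "f \<in> ?C" for F f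
    using that keys_tensor_act[OF M N] by simp
  obtain rep :: "'k um \<Rightarrow> ('k um \<times> 'k um) \<Rightarrow>\<^sub>0 'k" where rep: "comult x = abs_um2 (rep x)" for x
    using that[of "\<lambda>x. rep_um2 (comult x)"] by (simp add: Quotient_abs_rep[OF Quotient_um2])
  have smult: "x \<odot>\<^bsub>M \<otimes>\<^sub>m N\<^esub> ?t f = ?t (tensor_act M N (rep x) f)" if "f \<in> ?C" for x f
    using tensor_module_smult[OF M N _ rep] that by simp
  have smult': "x \<odot>\<^bsub>M \<otimes>\<^sub>m N\<^esub> ?t f = ?t (tensor_act M N F f)"
    if "f \<in> ?C" "comult x = abs_um2 F" for x f F
    using tensor_module_smult[OF M N _ that(2)] that(1) by simp
  have "abelian_group (M \<otimes>\<^sub>m N)"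
  proof (rule abelian_groupI)
    show "\<zero>\<^bsub>M \<otimes>\<^sub>m N\<^esub> \<in> carrier (M \<otimes>\<^sub>m N)"
      unfolding car zero by (rule imageI) simp
  next
    fix S assume "S \<in> carrier (M \<otimes>\<^sub>m N)"
    then obtain f where f: "f \<in> ?C" "S = ?t f" unfolding car by blast
    show "\<zero>\<^bsub>M \<otimes>\<^sub>m N\<^esub> \<oplus>\<^bsub>M \<otimes>\<^sub>m N\<^esub> S = S"
      unfolding f zero tensor_module_add by simp
    show "\<exists>T\<in>carrier (M \<otimes>\<^sub>m N). T \<oplus>\<^bsub>M \<otimes>\<^sub>m N\<^esub> S = \<zero>\<^bsub>M \<otimes>\<^sub>m N\<^esub>"
    proof
      show "?t (- f) \<oplus>\<^bsub>M \<otimes>\<^sub>m N\<^esub> S = \<zero>\<^bsub>M \<otimes>\<^sub>m N\<^esub>"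
        unfolding f zero tensor_module_add by simp
      show "?t (- f) \<in> carrier (M \<otimes>\<^sub>m N)"
        unfolding car by (rule imageI) (rule minus, rule f)
    qed
    fix T assume "T \<in> carrier (M \<otimes>\<^sub>m N)"
    then obtain g where g: "g \<in> ?C" "T = ?t g" unfolding car by blast
    show "S \<oplus>\<^bsub>M \<otimes>\<^sub>m N\<^esub> T \<in> carrier (M \<otimes>\<^sub>m N)"
      unfolding f g tensor_module_add car by (rule imageI) (rule plus, rule f, rule g)
    show "S \<oplus>\<^bsub>M \<otimes>\<^sub>m N\<^esub> T = T \<oplus>\<^bsub>M \<otimes>\<^sub>m N\<^esub> S"
      unfolding f g tensor_module_add by (simp add: add.commute)
    fix U assume "U \<in> carrier (M \<otimes>\<^sub>m N)"
    then obtain h where h: "h \<in> ?C" "U = ?t h" unfolding car by blast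
    show "S \<oplus>\<^bsub>M \<otimes>\<^sub>m N\<^esub> T \<oplus>\<^bsub>M \<otimes>\<^sub>m N\<^esub> U = S \<oplus>\<^bsub>M \<otimes>\<^sub>m N\<^esub> (T \<oplus>\<^bsub>M \<otimes>\<^sub>m N\<^esub> U)"
      unfolding f g h tensor_module_add by (simp add: add.assoc)
  qed
  moreover have "left_module_axioms (M \<otimes>\<^sub>m N)"
  proof
    fix S x y assume "S \<in> carrier (M \<otimes>\<^sub>m N)"
    then obtain f where f: "f \<in> ?C" "S = ?t f" unfolding car by blast
    show "x \<odot>\<^bsub>M \<otimes>\<^sub>m N\<^esub> S \<in> carrier (M \<otimes>\<^sub>m N)"
      unfolding f(2) smult[OF f(1)] car by (rule imageI) (rule act, rule f)
    have "comult (x + y) = abs_um2 (rep x + rep y)"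
      by (simp add: comult_hom[OF char] rep[symmetric] plus_um2.abs_eq[symmetric])
    from smult'[OF f(1) this] show "(x + y) \<odot>\<^bsub>M \<otimes>\<^sub>m N\<^esub> S =
        x \<odot>\<^bsub>M \<otimes>\<^sub>m N\<^esub> S \<oplus>\<^bsub>M \<otimes>\<^sub>m N\<^esub> y \<odot>\<^bsub>M \<otimes>\<^sub>m N\<^esub> S"
      unfolding f(2) smult[OF f(1)] tensor_module_add tensor_act_add_left .
    have "comult (x * y) = abs_um2 (tensor_act regular regular (rep x) (rep y))"
      by (simp add: comult_hom[OF char] rep[symmetric] times_um2.abs_eq[symmetric])
    from smult'[OF f(1) this] show "(x * y) \<odot>\<^bsub>M \<otimes>\<^sub>m N\<^esub> S =
        x \<odot>\<^bsub>M \<otimes>\<^sub>m N\<^esub> (y \<odot>\<^bsub>M \<otimes>\<^sub>m N\<^esub> S)"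
      unfolding f(2) smult[OF f(1)] smult[OF act[OF f(1)]] tensor_act_assoc[OF M N f(1)[simplified]] .
    have "comult 1 = abs_um2 (Poly_Mapping.single (1, 1) (1 :: 'k))"
      by (simp add: comult_hom[OF char] one_um2_def)
    from smult'[OF f(1) this] show "1 \<odot>\<^bsub>M \<otimes>\<^sub>m N\<^esub> S = S"
      unfolding f(2) tensor_act_one_left[OF M N f(1)[simplified]] .
    fix T assume "T \<in> carrier (M \<otimes>\<^sub>m N)"
    then obtain g where g: "g \<in> ?C" "T = ?t g" unfolding car by blast
    show "x \<odot>\<^bsub>M \<otimes>\<^sub>m N\<^esub> (S \<oplus>\<^bsub>M \<otimes>\<^sub>m N\<^esub> T) =
        x \<odot>\<^bsub>M \<otimes>\<^sub>m N\<^esub> S \<oplus>\<^bsub>M \<otimes>\<^sub>m N\<^esub> x \<odot>\<^bsub>M \<otimes>\<^sub>m N\<^esub> T"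
      unfolding f(2) g(2) tensor_module_add smult[OF plus[OF f(1) g(1)]] smult[OF f(1)] smult[OF g(1)]
        tensor_act_add_right ..
  qed
  ultimately show ?thesis by (rule left_module.intro)
qed


section \<open>The simple modules\<close>

definition free_act :: "('k::field \<Rightarrow> 'v \<Rightarrow> 'v) \<Rightarrow> (gen \<Rightarrow> 'v \<Rightarrow> 'v) \<Rightarrow> 'k free \<Rightarrow> 'v \<Rightarrow> 'v::ab_group_add"
  where "free_act scale \<rho> f v = lin_ext (\<lambda>w c. scale c (foldr \<rho> (letters w) v)) f"

text \<open>
  The module on the vector space \<open>'v\<close> on which the generators act by the operators \<open>\<rho>\<close>; this
  is meaningful only if \<open>\<rho>\<close> satisfies the relations of \<open>u(m)\<close>.
\<close>

definition gen_module ::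
    "('k::field \<Rightarrow> 'v \<Rightarrow> 'v) \<Rightarrow> (gen \<Rightarrow> 'v \<Rightarrow> 'v) \<Rightarrow> ('k um, 'v::ab_group_add) module" where
  "gen_module scale \<rho> = \<lparr>carrier = UNIV, mult = undefined, one = undefined, zero = 0, add = (+),
     smult = (\<lambda>x v. free_act scale \<rho> (rep_um x) v)\<rparr>"

definition V0 :: "('k::field um, 'k) module" where
  "V0 = gen_module (*) (\<lambda>_ _. 0)"

fun scale3 :: "'k::times \<Rightarrow> 'k \<times> 'k \<times> 'k \<Rightarrow> 'k \<times> 'k \<times> 'k" where
  "scale3 c (x, y, z) = (c * x, c * y, c * z)"

text \<open>The triple \<open>(x, y, z)\<close> stands for \<open>x v\<^sub>1 + y v\<^sub>2 + z v\<^sub>3\<close>.\<close>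

fun V1_gen :: "gen \<Rightarrow> 'k::zero \<times> 'k \<times> 'k \<Rightarrow> 'k \<times> 'k \<times> 'k" where
  "V1_gen GenA (x, y, z) = (0, x, y)"
| "V1_gen GenB (x, y, z) = (y, z, 0)"
| "V1_gen GenC (x, y, z) = (x, 0, z)"

definition V1 :: "('k::field um, 'k \<times> 'k \<times> 'k) module" where
  "V1 = gen_module scale3 V1_gen"

context
  fixes scale :: "'k::field \<Rightarrow> 'v::ab_group_add \<Rightarrow> 'v" and \<rho> :: "gen \<Rightarrow> 'v \<Rightarrow> 'v"
  assumes vs: "vector_space scale"
    and \<rho>_add: "\<And>g x y. \<rho> g (x + y) = \<rho> g x + \<rho> g y"
    and \<rho>_scale: "\<And>g c x. \<rho> g (scale c x) = scale c (\<rho> g x)"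
begin

interpretation vector_space scale by (rule vs)

lemma free_act_add: "free_act scale \<rho> (f + g) v = free_act scale \<rho> f v + free_act scale \<rho> g v"
  unfolding free_act_def by (rule lin_ext_add) (simp_all add: scale_left_distrib)

lemma free_act_single:
  "free_act scale \<rho> (Poly_Mapping.single w c) v = scale c (foldr \<rho> (letters w) v)"
  unfolding free_act_def by (rule lin_ext_single) simp

lemma free_act_zero: "free_act scale \<rho> 0 v = 0"
  by (simp add: free_act_def)

lemma free_act_diff: "free_act scale \<rho> (f - g) v = free_act scale \<rho> f v - free_act scale \<rho> g v"
  using free_act_add[of "f - g" g v] by (simp add: eq_diff_eq)

lemma foldr_add: "foldr \<rho> gs (x + y) = foldr \<rho> gs x + foldr \<rho> gs y"
  by (induction gs) (simp_all add: \<rho>_add)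

lemma foldr_scale: "foldr \<rho> gs (scale c x) = scale c (foldr \<rho> gs x)"
  by (induction gs) (simp_all add: \<rho>_scale)

lemma free_act_add_right:
  "free_act scale \<rho> f (x + y) = free_act scale \<rho> f x + free_act scale \<rho> f y"
  by (induction f rule: poly_mapping_add_induct)
    (simp_all add: free_act_zero free_act_single free_act_add foldr_add scale_right_distrib add_ac)

lemma free_act_zero_right: "free_act scale \<rho> f 0 = 0"
  using free_act_add_right[of f 0 0] by simp

lemma free_act_mult: "free_act scale \<rho> (f * g) v = free_act scale \<rho> f (free_act scale \<rho> g v)"
proof (induction f rule: poly_mapping_add_induct)
  case (single p c)
  show ?case
    by (induction g rule: poly_mapping_add_induct)
      (simp_all add: free_act_zero free_act_zero_right mult_single free_act_single plus_word_def
        foldr_scale distrib_left free_act_add free_act_add_right)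
qed (simp_all add: free_act_zero distrib_right free_act_add)

lemma free_act_one: "free_act scale \<rho> 1 v = v"
proof -
  have "free_act scale \<rho> (Poly_Mapping.single 0 1) v = v"
    unfolding free_act_single by (simp add: zero_word_def)
  then show ?thesis by simp
qed

lemma free_act_gen: "free_act scale \<rho> (free_gen g) v = \<rho> g v"
  by (simp add: free_gen_def free_act_single)

context
  assumes rels: "\<And>r v. r \<in> um_relations \<Longrightarrow> free_act scale \<rho> r v = 0"
begin

lemma free_act_ideal: "r \<in> um_ideal \<Longrightarrow> free_act scale \<rho> r v = 0"
  by (induction arbitrary: v rule: um_ideal.induct)
    (simp_all add: rels free_act_add free_act_mult free_act_zero_right)

lemma gen_module_smult: "abs_um f \<odot>\<^bsub>gen_module scale \<rho>\<^esub> v = free_act scale \<rho> f v"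
proof -
  have "abs_um (rep_um (abs_um f)) = abs_um f"
    by (rule Quotient_abs_rep[OF Quotient_um])
  then have "rep_um (abs_um f) - f \<in> um_ideal"
    by (simp only: um.abs_eq_iff)
  from free_act_ideal[OF this] show ?thesis
    by (simp add: gen_module_def free_act_diff)
qed

lemma gen_module_gen: "um_gen g \<odot>\<^bsub>gen_module scale \<rho>\<^esub> v = \<rho> g v"
  by (simp add: um_gen_def gen_module_smult free_act_gen)

lemma left_module_gen_module: "left_module (gen_module scale \<rho>)"
proof (intro left_module.intro)
  show "abelian_group (gen_module scale \<rho>)"
    by (rule abelian_groupI)
      (auto simp: gen_module_def algebra_simps intro: exI[of _ "- x" for x])
  show "left_module_axioms (gen_module scale \<rho>)"
  proof
    fix x y :: "'k um" and v w
    obtain f g where xy: "x = abs_um f" "y = abs_um g"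
      using Quotient_abs_rep[OF Quotient_um] by metis
    show "(x + y) \<odot>\<^bsub>gen_module scale \<rho>\<^esub> v =
        x \<odot>\<^bsub>gen_module scale \<rho>\<^esub> v \<oplus>\<^bsub>gen_module scale \<rho>\<^esub> y \<odot>\<^bsub>gen_module scale \<rho>\<^esub> v"
      unfolding xy plus_um.abs_eq gen_module_smult free_act_add by (simp add: gen_module_def)
    show "x \<odot>\<^bsub>gen_module scale \<rho>\<^esub> (v \<oplus>\<^bsub>gen_module scale \<rho>\<^esub> w) =
        x \<odot>\<^bsub>gen_module scale \<rho>\<^esub> v \<oplus>\<^bsub>gen_module scale \<rho>\<^esub> x \<odot>\<^bsub>gen_module scale \<rho>\<^esub> w"
      unfolding xy gen_module_smult by (simp add: gen_module_def free_act_add_right)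
    show "(x * y) \<odot>\<^bsub>gen_module scale \<rho>\<^esub> v =
        x \<odot>\<^bsub>gen_module scale \<rho>\<^esub> (y \<odot>\<^bsub>gen_module scale \<rho>\<^esub> v)"
      unfolding xy times_um.abs_eq gen_module_smult free_act_mult ..
    show "1 \<odot>\<^bsub>gen_module scale \<rho>\<^esub> v = v"
      unfolding one_um_def by (simp add: gen_module_smult free_act_one)
  qed (simp add: gen_module_def)
qed

end

end

lemma V0_module:
  shows "left_module (V0 :: ('k::field um, 'k) module)"
    and "um_gen g \<odot>\<^bsub>V0\<^esub> (v :: 'k) = 0"
proof -
  have vs: "vector_space ((*) :: 'k \<Rightarrow> 'k \<Rightarrow> 'k)"
    by standard (simp_all add: algebra_simps)
  have zero_lin: "(0 :: 'k) = 0 + 0" "(0 :: 'k) = c * 0" for c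
    by simp_all
  note lin = vs zero_lin
  let ?\<rho> = "(\<lambda>_ _. 0) :: gen \<Rightarrow> 'k \<Rightarrow> 'k"
  note act = free_act_add[where \<rho> = ?\<rho>, OF lin] free_act_diff[where \<rho> = ?\<rho>, OF lin]
    free_act_mult[where \<rho> = ?\<rho>, OF lin] free_act_gen[where \<rho> = ?\<rho>, OF lin]
  have rels: "free_act (*) (\<lambda>_ _. 0) r v = 0" if "r \<in> um_relations" for r and v :: 'k
    using that by (auto simp: um_relations_def Let_def act power2_eq_square power4_eq_xxxx)
  show "left_module (V0 :: ('k um, 'k) module)"
    unfolding V0_def by (rule left_module_gen_module[where \<rho> = ?\<rho>, OF lin rels])
  show "um_gen g \<odot>\<^bsub>V0\<^esub> v = 0"
    unfolding V0_def by (rule gen_module_gen[where \<rho> = ?\<rho>, OF lin rels])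
qed

lemma V1_module:
  assumes char: "CHAR('k::field) = 2"
  shows "left_module (V1 :: ('k um, 'k \<times> 'k \<times> 'k) module)"
    and "um_gen g \<odot>\<^bsub>V1\<^esub> (v :: 'k \<times> 'k \<times> 'k) = V1_gen g v"
proof -
  have "(1 :: 'k) + 1 = 0"
    using of_nat_CHAR[where 'a = 'k] char by simp
  then have double: "x + x = 0" for x :: 'k
    by (metis distrib_right mult_1 mult_zero_left)
  have vs: "vector_space (scale3 :: 'k \<Rightarrow> _)"
    by standard (auto simp: algebra_simps)
  have add: "V1_gen g (x + y) = V1_gen g x + V1_gen g y" for g and x y :: "'k \<times> 'k \<times> 'k"
    by (cases g; cases x; cases y) simp_all
  have scale: "V1_gen g (scale3 c x) = scale3 c (V1_gen g x)" for g c and x :: "'k \<times> 'k \<times> 'k"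
    by (cases g; cases x) simp_all
  note act = free_act_add[where \<rho> = V1_gen, OF vs add scale] free_act_diff[where \<rho> = V1_gen, OF vs add scale]
    free_act_mult[where \<rho> = V1_gen, OF vs add scale] free_act_gen[where \<rho> = V1_gen, OF vs add scale]
  have rels: "free_act scale3 V1_gen r v = 0" if "r \<in> um_relations" for r and v :: "'k \<times> 'k \<times> 'k"
    using that
    by (cases v) (auto simp: um_relations_def Let_def act power2_eq_square power4_eq_xxxx
        double zero_prod_def)
  show "left_module (V1 :: ('k um, 'k \<times> 'k \<times> 'k) module)"
    unfolding V1_def by (rule left_module_gen_module[where \<rho> = V1_gen, OF vs add scale rels])
  show "um_gen g \<odot>\<^bsub>V1\<^esub> v = V1_gen g v"
    unfolding V1_def by (rule gen_module_gen[where \<rho> = V1_gen, OF vs add scale rels])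
qed

end

theory Submission
  imports Defs
begin

text \<open>
  \<open>P\<^sub>0\<close> and \<open>P\<^sub>1\<close> are the cyclic modules generated by \<open>q\<close> subject to \<open>c q = a b a q = b\<^sup>2 a q = 0\<close>
  and to \<open>c q = q\<close>, \<open>a\<^sup>2 q = 0\<close>, respectively. Both have dimension 8, and they are direct summands
  of the regular module: \<open>q\<close> corresponds to the idempotent \<open>(1 + a b + a\<^sup>2 b\<^sup>2) (1 + c)\<close>,
  respectively \<open>a\<^sup>2 b\<^sup>2 c\<close>. The kernel of the map onto the simple quotient is superfluous because
  an element congruent to \<open>q\<close> is moved by the idempotent to \<open>q + \<beta> b a q\<close>, and
  \<open>1 + \<beta> b a\<close> moves that to \<open>q\<close>. By the uniqueness of projective covers every projective cover is
  isomorphic to one of these models, and for the models both decompositions are given by explicit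
  invertible \<open>24 \<times> 24\<close> matrices over the field with two elements.
\<close>

text \<open>The idempotents come from the simple modules. \<open>idem0\<close> acts as 1 on V_0; on
  V_1 the factor \<open>1 + uc\<close> leaves only v_2, which 1 + a b + a^2 b^2 sends to v_2 + v_2 =
  0. \<open>idem1\<close> kills V_0 and projects V_1 onto the line of v_3, because a^2 b^2 v_3 =
  v_3. The obstacle is that the covers are known only by a universal property, on arbitrary types,
  and that a general element of u(m) acts through a chosen representative. Hence homomorphisms are
  checked on scalars and generators, and a tensor product with V_1 is replaced by triples: in the
  basis v_1, v_2, v_3 a generator acts componentwise plus by its 0-1 matrix on V_1. That a model is
  a summand of the regular module is witnessed inside the model: mapping it into u(m) and then
  evaluating at q is the identity. Linear independence of monomials in u(m) therefore never enters.
  The matrices come from vectors w of the tensor product that satisfy the relations of q: c w = w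
  and a^2 w = 0 for a copy of P_1, c w = a b a w = b^2 a w = 0 for a copy of P_0.\<close>

lemma um_induct [case_names scalar gen add]:
  fixes x :: "'k::field um"
  assumes "\<And>c. P (um_scalar c)" "\<And>g x. P x \<Longrightarrow> P (um_gen g * x)"
    "\<And>x y. P x \<Longrightarrow> P y \<Longrightarrow> P (x + y)"
  shows "P x"
proof -
  obtain f where x: "x = abs_um f"
    using Quotient_abs_rep[OF Quotient_um] by metis
  show ?thesis
    unfolding x
  proof (induction f rule: poly_mapping_add_induct)
    case zero
    have "um_scalar 0 = abs_um (0 :: 'k free)" by (simp add: um_scalar_def)
    with assms(1)[of 0] show ?case by simp
  next
    case (single w c)
    obtain gs where "w = Word gs" by (cases w)
    \<comment> \<open>The coefficient stays with the empty word while letters are prepended, so each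
      letter is a left multiplication by a generator.\<close>
    moreover have "P (abs_um (Poly_Mapping.single (Word gs) c))"
    proof (induction gs)
      case Nil
      then show ?case using assms(1)[of c] by (simp add: um_scalar_def zero_word_def)
    next
      case (Cons g gs)
      have "Poly_Mapping.single (Word (g # gs)) c = free_gen g * Poly_Mapping.single (Word gs) c"
        by (simp add: free_gen_def mult_single plus_word_def)
      then show ?case
        using assms(2)[OF Cons, of g] by (simp add: um_gen_def times_um.abs_eq)
    qed
    ultimately show ?case by simp
  next
    case (add f g)
    then show ?case using assms(3) by (simp add: plus_um.abs_eq[symmetric])
  qed
qed

section \<open>Homomorphisms\<close>

lemma mod_homI:
  assumes "\<And>x. x \<in> carrier M \<Longrightarrow> h x \<in> carrier N"
    "\<And>x y. x \<in> carrier M \<Longrightarrow> y \<in> carrier M \<Longrightarrow> h (x \<oplus>\<^bsub>M\<^esub> y) = h x \<oplus>\<^bsub>N\<^esub> h y"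
    "\<And>r x. x \<in> carrier M \<Longrightarrow> h (r \<odot>\<^bsub>M\<^esub> x) = r \<odot>\<^bsub>N\<^esub> h x"
  shows "h \<in> mod_hom M N"
  using assms by (auto simp: mod_hom_def)

lemma mod_homD:
  assumes "h \<in> mod_hom M N"
  shows "x \<in> carrier M \<Longrightarrow> h x \<in> carrier N"
    "x \<in> carrier M \<Longrightarrow> y \<in> carrier M \<Longrightarrow> h (x \<oplus>\<^bsub>M\<^esub> y) = h x \<oplus>\<^bsub>N\<^esub> h y"
    "x \<in> carrier M \<Longrightarrow> h (r \<odot>\<^bsub>M\<^esub> x) = r \<odot>\<^bsub>N\<^esub> h x"
  using assms by (auto simp: mod_hom_def)

lemma mod_hom_comp: "f \<in> mod_hom L M \<Longrightarrow> g \<in> mod_hom M N \<Longrightarrow> g \<circ> f \<in> mod_hom L N"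
  by (rule mod_homI) (simp_all add: mod_homD[of f] mod_homD[of g])

lemma mod_hom_zero:
  assumes "left_module M" "left_module N" "h \<in> mod_hom M N"
  shows "h \<zero>\<^bsub>M\<^esub> = \<zero>\<^bsub>N\<^esub>"
proof -
  interpret M: left_module M by fact
  interpret N: left_module N by fact
  have "h \<zero>\<^bsub>M\<^esub> \<oplus>\<^bsub>N\<^esub> h \<zero>\<^bsub>M\<^esub> = h \<zero>\<^bsub>M\<^esub>"
    using mod_homD(2)[OF assms(3) M.zero_closed M.zero_closed] by simp
  then show ?thesis
    using mod_homD(1)[OF assms(3) M.zero_closed] N.add.r_cancel_one by metis
qed

text \<open>Compatibility with \<open>r\<close> passes to \<open>um_gen g * r\<close> by
  associativity of the action and to sums by distributivity, and \<open>um_induct\<close> reaches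
  every \<open>r\<close> in this way.\<close>

lemma mod_hom_gensI:
  fixes M :: "('k::field um, 'v) module"
  assumes M: "left_module M" and N: "left_module N"
    and closed: "\<And>x. x \<in> carrier M \<Longrightarrow> h x \<in> carrier N"
    and add: "\<And>x y. x \<in> carrier M \<Longrightarrow> y \<in> carrier M \<Longrightarrow> h (x \<oplus>\<^bsub>M\<^esub> y) = h x \<oplus>\<^bsub>N\<^esub> h y"
    and scalar: "\<And>c x. x \<in> carrier M \<Longrightarrow> h (um_scalar c \<odot>\<^bsub>M\<^esub> x) = um_scalar c \<odot>\<^bsub>N\<^esub> h x"
    and gen: "\<And>g x. x \<in> carrier M \<Longrightarrow> h (um_gen g \<odot>\<^bsub>M\<^esub> x) = um_gen g \<odot>\<^bsub>N\<^esub> h x"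
  shows "h \<in> mod_hom M N"
proof (rule mod_homI)
  interpret M: left_module M by fact
  interpret N: left_module N by fact
  fix r x assume x: "x \<in> carrier M"
  show "h (r \<odot>\<^bsub>M\<^esub> x) = r \<odot>\<^bsub>N\<^esub> h x"
    by (induction r rule: um_induct)
      (simp_all add: x closed scalar M.smult_assoc N.smult_assoc gen add M.smult_closed
        M.smult_l_distr N.smult_l_distr)
qed (fact closed add)+

lemma mod_isoI:
  assumes "h \<in> mod_hom M N" "h' \<in> carrier N \<rightarrow> carrier M"
    "\<And>x. x \<in> carrier M \<Longrightarrow> h' (h x) = x" "\<And>y. y \<in> carrier N \<Longrightarrow> h (h' y) = y"
  shows "M \<simeq> N"
proof -
  have "bij_betw h (carrier M) (carrier N)"
    by (rule bij_betw_byWitness[where f' = h']) (use assms mod_homD(1) in \<open>auto\<close>)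
  with assms(1) show ?thesis unfolding mod_iso_def by blast
qed

lemma mod_isoE:
  assumes "left_module M" "M \<simeq> N"
  obtains h h' where "h \<in> mod_hom M N" "h' \<in> mod_hom N M"
    "\<And>x. x \<in> carrier M \<Longrightarrow> h' (h x) = x" "\<And>y. y \<in> carrier N \<Longrightarrow> h (h' y) = y"
proof -
  interpret M: left_module M by fact
  obtain h where h: "h \<in> mod_hom M N" and bij: "bij_betw h (carrier M) (carrier N)"
    using assms(2) by (auto simp: mod_iso_def)
  define h' where "h' = inv_into (carrier M) h"
  have 1: "h' (h x) = x" if "x \<in> carrier M" for x
    unfolding h'_def using bij that by (rule bij_betw_inv_into_left)
  have 2: "h (h' y) = y" if "y \<in> carrier N" for y
    unfolding h'_def using bij that by (rule bij_betw_inv_into_right)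
  have 3: "h' y \<in> carrier M" if "y \<in> carrier N" for y
    using bij_betw_inv_into[OF bij] that by (auto simp: h'_def bij_betw_def)
  have "h' \<in> mod_hom N M"
  proof (rule mod_homI)
    fix x y assume xy: "x \<in> carrier N" "y \<in> carrier N"
    have "x \<oplus>\<^bsub>N\<^esub> y = h (h' x \<oplus>\<^bsub>M\<^esub> h' y)"
      using mod_homD(2)[OF h 3[OF xy(1)] 3[OF xy(2)]] by (simp add: 2 xy)
    then show "h' (x \<oplus>\<^bsub>N\<^esub> y) = h' x \<oplus>\<^bsub>M\<^esub> h' y"
      using 1 3 xy by simp
  next
    fix r x assume x: "x \<in> carrier N"
    have "r \<odot>\<^bsub>N\<^esub> x = h (r \<odot>\<^bsub>M\<^esub> h' x)"
      using mod_homD(3)[OF h 3[OF x]] by (simp add: 2 x)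
    then show "h' (r \<odot>\<^bsub>N\<^esub> x) = r \<odot>\<^bsub>M\<^esub> h' x"
      using 1 3 x M.smult_closed by simp
  qed (rule 3)
  with h 1 2 show thesis by (intro that)
qed

lemma mod_iso_sym: "left_module M \<Longrightarrow> M \<simeq> N \<Longrightarrow> N \<simeq> M"
  by (erule (1) mod_isoE, rule mod_isoI) (auto dest: mod_homD(1))

lemma mod_iso_trans: "L \<simeq> M \<Longrightarrow> M \<simeq> N \<Longrightarrow> L \<simeq> N"
  unfolding mod_iso_def using mod_hom_comp bij_betw_trans by blast

section \<open>Direct sums and multiples of a module\<close>

lemma direct_sum_simps [simp]:
  "carrier (M \<oplus>\<^sub>d N) = carrier M \<times> carrier N"
  "\<zero>\<^bsub>M \<oplus>\<^sub>d N\<^esub> = (\<zero>\<^bsub>M\<^esub>, \<zero>\<^bsub>N\<^esub>)"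
  "(x, y) \<oplus>\<^bsub>M \<oplus>\<^sub>d N\<^esub> (x', y') = (x \<oplus>\<^bsub>M\<^esub> x', y \<oplus>\<^bsub>N\<^esub> y')"
  "r \<odot>\<^bsub>M \<oplus>\<^sub>d N\<^esub> (x, y) = (r \<odot>\<^bsub>M\<^esub> x, r \<odot>\<^bsub>N\<^esub> y)"
  by (simp_all add: direct_sum_def)

lemma copies_simps [simp]:
  "carrier (copies n M) = {..<n} \<rightarrow>\<^sub>E carrier M"
  "\<zero>\<^bsub>copies n M\<^esub> = (\<lambda>i\<in>{..<n}. \<zero>\<^bsub>M\<^esub>)"
  "x \<oplus>\<^bsub>copies n M\<^esub> y = (\<lambda>i\<in>{..<n}. x i \<oplus>\<^bsub>M\<^esub> y i)"
  "r \<odot>\<^bsub>copies n M\<^esub> x = (\<lambda>i\<in>{..<n}. r \<odot>\<^bsub>M\<^esub> x i)"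
  by (simp_all add: copies_def)

lemma left_module_direct_sum:
  assumes "left_module M" "left_module N"
  shows "left_module (M \<oplus>\<^sub>d N)"
proof -
  interpret M: left_module M by fact
  interpret N: left_module N by fact
  have "abelian_group (M \<oplus>\<^sub>d N)"
    by (rule abelian_groupI)
      (auto simp: M.a_ac N.a_ac intro: M.l_neg N.l_neg)
  moreover have "left_module_axioms (M \<oplus>\<^sub>d N)"
    by standard
      (auto simp: M.smult_closed N.smult_closed M.smult_l_distr N.smult_l_distr M.smult_r_distr
        N.smult_r_distr M.smult_assoc N.smult_assoc M.smult_one N.smult_one)
  ultimately show ?thesis by (rule left_module.intro)
qed

lemma left_module_copies:
  assumes "left_module M"
  shows "left_module (copies n M)"
proof -
  interpret M: left_module M by fact
  have "abelian_group (copies n M)"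
  proof (rule abelian_groupI)
    fix x assume x: "x \<in> carrier (copies n M)"
    show "\<exists>y\<in>carrier (copies n M). y \<oplus>\<^bsub>copies n M\<^esub> x = \<zero>\<^bsub>copies n M\<^esub>"
      by (rule bexI[of _ "\<lambda>i\<in>{..<n}. \<ominus>\<^bsub>M\<^esub> x i"])
        (use x in \<open>auto simp: PiE_iff M.l_neg intro!: restrict_ext\<close>)
  qed (auto simp: PiE_iff M.a_ac extensional_def fun_eq_iff)
  moreover have "left_module_axioms (copies n M)"
    by standard
      (auto simp: PiE_iff M.smult_closed M.smult_l_distr M.smult_r_distr M.smult_assoc M.smult_one
        extensional_def fun_eq_iff)
  ultimately show ?thesis by (rule left_module.intro)
qed

lemma direct_sum_mod_iso:
  assumes "left_module M" "left_module N" "M \<simeq> M'" "N \<simeq> N'"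
  shows "M \<oplus>\<^sub>d N \<simeq> M' \<oplus>\<^sub>d N'"
proof -
  obtain f f' where f: "f \<in> mod_hom M M'" "f' \<in> mod_hom M' M"
      "\<And>x. x \<in> carrier M \<Longrightarrow> f' (f x) = x" "\<And>y. y \<in> carrier M' \<Longrightarrow> f (f' y) = y"
    using mod_isoE[OF assms(1,3)] by metis
  obtain g g' where g: "g \<in> mod_hom N N'" "g' \<in> mod_hom N' N"
      "\<And>x. x \<in> carrier N \<Longrightarrow> g' (g x) = x" "\<And>y. y \<in> carrier N' \<Longrightarrow> g (g' y) = y"
    using mod_isoE[OF assms(2,4)] by metis
  show ?thesis
    by (rule mod_isoI[where h = "map_prod f g" and h' = "map_prod f' g'"])
      (use f g in \<open>auto intro!: mod_homI simp: mod_homD[OF f(1)] mod_homD[OF f(2)]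
        mod_homD[OF g(1)] mod_homD[OF g(2)]\<close>)
qed

lemma copies_1_mod_iso: "M \<simeq> copies 1 M"
proof (rule mod_isoI)
  show "(\<lambda>x. \<lambda>i\<in>{..<1}. x) \<in> mod_hom M (copies 1 M)"
    by (rule mod_homI) auto
  show "(\<lambda>f. f 0) \<in> carrier (copies 1 M) \<rightarrow> carrier M"
    by (auto simp: PiE_iff)
qed (auto simp: PiE_iff extensional_def fun_eq_iff)

text \<open>Coordinate 0 splits off and the others move down by one. Started at
  \<open>copies 1\<close>, this turns nested direct sums into \<open>copies n\<close>.\<close>

lemma copies_Suc_mod_iso: "copies (Suc n) M \<simeq> M \<oplus>\<^sub>d copies n M"
proof (rule mod_isoI)
  let ?h = "\<lambda>f. (f 0, \<lambda>i\<in>{..<n}. f (Suc i))"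
  let ?h' = "\<lambda>z. \<lambda>i\<in>{..<Suc n}. if i = 0 then fst z else snd z (i - 1)"
  show "?h \<in> mod_hom (copies (Suc n) M) (M \<oplus>\<^sub>d copies n M)"
    by (rule mod_homI) (simp_all add: PiE_iff restrict_def extensional_def fun_eq_iff)
  show "?h' \<in> carrier (M \<oplus>\<^sub>d copies n M) \<rightarrow> carrier (copies (Suc n) M)"
  proof
    fix z assume "z \<in> carrier (M \<oplus>\<^sub>d copies n M)"
    then have z: "fst z \<in> carrier M" "snd z \<in> {..<n} \<rightarrow>\<^sub>E carrier M"
      by (simp_all add: mem_Times_iff)
    show "?h' z \<in> carrier (copies (Suc n) M)"
      unfolding copies_simps
    proof (rule restrict_PiE_iff[THEN iffD2], rule ballI)
      fix i assume "i \<in> {..<Suc n}"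
      then show "(if i = 0 then fst z else snd z (i - 1)) \<in> carrier M"
        using z(1) PiE_mem[OF z(2)] by (cases i) simp_all
    qed
  qed
  show "?h' (?h f) = f" if "f \<in> carrier (copies (Suc n) M)" for f
  proof
    fix i show "?h' (?h f) i = f i"
      using that by (cases i) (simp_all add: PiE_iff extensional_def)
  qed
  show "?h (?h' z) = z" if "z \<in> carrier (M \<oplus>\<^sub>d copies n M)" for z
  proof -
    \<comment> \<open>Elements of \<open>copies n M\<close> are \<open>undefined\<close> off
      \<open>{..<n}\<close>, so restricting the shifted function gives back \<open>snd z\<close>
      itself.\<close>
    have "snd z \<in> extensional {..<n}" using that by (simp add: mem_Times_iff PiE_iff)
    then have "(\<lambda>i\<in>{..<n}. ?h' z (Suc i)) = snd z"
      by (simp add: fun_eq_iff restrict_def extensional_def)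
    then show ?thesis by (simp add: prod_eq_iff)
  qed
qed

section \<open>Projective covers\<close>

definition transport :: "('v \<Rightarrow> 'w) \<Rightarrow> ('r, 'v) module \<Rightarrow> ('r, 'w) module" where
  "transport \<iota> M = (let j = inv_into (carrier M) \<iota> in
     \<lparr>carrier = \<iota> ` carrier M, mult = undefined, one = undefined, zero = \<iota> \<zero>\<^bsub>M\<^esub>,
      add = (\<lambda>x y. \<iota> (j x \<oplus>\<^bsub>M\<^esub> j y)), smult = (\<lambda>r x. \<iota> (r \<odot>\<^bsub>M\<^esub> j x))\<rparr>)"

lemma transport_simps:
  "carrier (transport \<iota> M) = \<iota> ` carrier M"
  "\<zero>\<^bsub>transport \<iota> M\<^esub> = \<iota> \<zero>\<^bsub>M\<^esub>"
  "inj_on \<iota> (carrier M) \<Longrightarrow> x \<in> carrier M \<Longrightarrow> y \<in> carrier M \<Longrightarrow>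
    \<iota> x \<oplus>\<^bsub>transport \<iota> M\<^esub> \<iota> y = \<iota> (x \<oplus>\<^bsub>M\<^esub> y)"
  "inj_on \<iota> (carrier M) \<Longrightarrow> x \<in> carrier M \<Longrightarrow> r \<odot>\<^bsub>transport \<iota> M\<^esub> \<iota> x = \<iota> (r \<odot>\<^bsub>M\<^esub> x)"
  by (simp_all add: transport_def Let_def)

lemma left_module_transport:
  assumes "left_module M" and inj: "inj_on \<iota> (carrier M)"
  shows "left_module (transport \<iota> M)"
proof -
  interpret M: left_module M by fact
  note simps = transport_simps(1,2) transport_simps(3,4)[OF inj]
  have "abelian_group (transport \<iota> M)"
    by (rule abelian_groupI) (auto simp: simps M.a_ac M.r_neg intro!: bexI[OF _ M.a_inv_closed])
  moreover have "left_module_axioms (transport \<iota> M)"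
    by standard (auto simp: simps M.smult_closed M.smult_l_distr M.smult_r_distr M.smult_assoc
        M.smult_one)
  ultimately show ?thesis by (rule left_module.intro)
qed

lemma mod_hom_orbit:
  assumes "left_module M" "m \<in> carrier M"
  shows "(\<lambda>r. r \<odot>\<^bsub>M\<^esub> m) \<in> mod_hom regular M"
  using assms by (auto intro!: mod_homI simp: left_module.smult_closed left_module.smult_l_distr
      left_module.smult_assoc)

text \<open>
  The carriers of the test modules in \<^const>\<open>projective\<close> have to lie in \<open>'v \<Rightarrow>\<^sub>0 'k um\<close>, hence
  the copies of the regular module and of \<open>P\<close> in that type.
\<close>

lemma projective_cyclic_section:
  fixes P :: "('k::field um, 'v) module"
  assumes proj: "projective P" and m: "m \<in> carrier P"
    and cyclic: "\<And>x. x \<in> carrier P \<Longrightarrow> \<exists>r. r \<odot>\<^bsub>P\<^esub> m = x"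
  obtains s where "s \<in> mod_hom P regular" "\<And>x. x \<in> carrier P \<Longrightarrow> s x \<odot>\<^bsub>P\<^esub> m = x"
proof -
  have P: "left_module P" using proj by (simp add: projective_def)
  interpret P: left_module P by fact
  \<comment> \<open>A ring element is stored as the coefficient of one fixed key; a module element
    is stored as the key of the coefficient 1, and recovered from it because 1 is not 0 in
    u(m).\<close>
  let ?\<iota> = "Poly_Mapping.single undefined :: 'k um \<Rightarrow> 'v \<Rightarrow>\<^sub>0 'k um"
  let ?\<kappa> = "\<lambda>x. Poly_Mapping.single x 1 :: 'v \<Rightarrow>\<^sub>0 'k um"
  let ?M = "transport ?\<iota> regular" and ?N = "transport ?\<kappa> P"
  let ?g = "\<lambda>y. ?\<kappa> (Poly_Mapping.lookup y undefined \<odot>\<^bsub>P\<^esub> m)"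
  have inj_\<iota>: "inj_on ?\<iota> (carrier regular)"
    by (auto intro!: inj_onI dest: arg_cong[where f = "\<lambda>y. Poly_Mapping.lookup y undefined"])
  have inj_\<kappa>: "inj_on ?\<kappa> (carrier P)"
    by (auto intro!: inj_onI dest: arg_cong[where f = Poly_Mapping.keys])
  note simps = transport_simps(1,2) transport_simps(3,4)[OF inj_\<iota>] transport_simps(3,4)[OF inj_\<kappa>]
  have "?g \<in> mod_hom ?M ?N"
    by (rule mod_homI)
      (auto simp: simps m P.smult_closed P.smult_l_distr P.smult_assoc)
  moreover have "?g ` carrier ?M = carrier ?N"
  proof -
    have "?\<kappa> x \<in> ?g ` carrier ?M" if x: "x \<in> carrier P" for x
    proof -
      obtain r where "r \<odot>\<^bsub>P\<^esub> m = x" using cyclic[OF x] by blast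
      then have "?\<kappa> x = ?g (?\<iota> r)" by simp
      then show ?thesis unfolding simps by (intro image_eqI) auto
    qed
    then show ?thesis by (auto simp: simps m P.smult_closed)
  qed
  moreover have "?\<kappa> \<in> mod_hom P ?N"
    by (rule mod_homI) (auto simp: simps)
  moreover have "left_module ?M" "left_module ?N"
    using left_module_transport inj_\<iota> inj_\<kappa> left_module_regular P by blast+
  \<comment> \<open>The map to be lifted is the identity of \<open>P\<close> up to the renaming
    \<open>?\<kappa>\<close>, so the lift splits the surjection r \<mapsto> r m.\<close>
  ultimately have "\<exists>h\<in>mod_hom P ?M. \<forall>x\<in>carrier P. ?g (h x) = ?\<kappa> x"
    by (intro conjunct2[OF proj[unfolded projective_def], rule_format, of ?M ?N ?g ?\<kappa>] conjI)
  then obtain h where h: "h \<in> mod_hom P ?M" "\<And>x. x \<in> carrier P \<Longrightarrow> ?g (h x) = ?\<kappa> x"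
    by blast
  show thesis
  proof (rule that)
    have "(\<lambda>y. Poly_Mapping.lookup y undefined) \<in> mod_hom ?M regular"
      by (rule mod_homI) (auto simp: simps)
    from mod_hom_comp[OF h(1) this]
    show "(\<lambda>x. Poly_Mapping.lookup (h x) undefined) \<in> mod_hom P regular"
      by (simp add: comp_def)
    fix x assume x: "x \<in> carrier P"
    show "Poly_Mapping.lookup (h x) undefined \<odot>\<^bsub>P\<^esub> m = x"
      using arg_cong[OF h(2)[OF x], of Poly_Mapping.keys] by simp
  qed
qed

lemma left_submodule_image:
  assumes "left_module M" "left_module N" "h \<in> mod_hom M N"
  shows "left_submodule (h ` carrier M) N"
proof -
  interpret M: left_module M by fact
  interpret N: left_module N by fact
  note h = mod_homD[OF assms(3)]
  show ?thesis
    unfolding left_submodule_def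
  proof (intro conjI ballI allI)
    show "\<zero>\<^bsub>N\<^esub> \<in> h ` carrier M"
      using mod_hom_zero[OF assms] M.zero_closed by (metis imageI)
  next
    fix x y assume "x \<in> h ` carrier M" "y \<in> h ` carrier M"
    then obtain x' y' where "x' \<in> carrier M" "y' \<in> carrier M" "x = h x'" "y = h y'" by blast
    then show "x \<oplus>\<^bsub>N\<^esub> y \<in> h ` carrier M"
      using h(2) M.a_closed by (metis imageI)
  next
    fix r x assume "x \<in> h ` carrier M"
    then obtain x' where "x' \<in> carrier M" "x = h x'" by blast
    then show "r \<odot>\<^bsub>N\<^esub> x \<in> h ` carrier M"
      using h(3) M.smult_closed by (metis imageI)
  qed (use h(1) in blast)
qed

text \<open>
  The image of \<open>h\<close> and the kernel of \<open>\<pi>\<close> span \<open>P\<close>, because \<open>\<pi>\<close> already maps the image of \<open>h\<close>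
  onto everything.
\<close>

lemma surj_of_superfluous_kernel:
  assumes M: "left_module M" and P: "left_module P" and V: "left_module V"
    and h: "h \<in> mod_hom M P" and \<pi>: "\<pi> \<in> mod_hom P V"
    and sup: "superfluous {x \<in> carrier P. \<pi> x = \<zero>\<^bsub>V\<^esub>} P"
    and onto: "\<And>x. x \<in> carrier P \<Longrightarrow> \<exists>y\<in>carrier M. \<pi> (h y) = \<pi> x"
  shows "h ` carrier M = carrier P"
proof -
  interpret P: left_module P by fact
  interpret V: left_module V by fact
  let ?K = "{x \<in> carrier P. \<pi> x = \<zero>\<^bsub>V\<^esub>}"
  have "x \<in> {u \<oplus>\<^bsub>P\<^esub> k | u k. u \<in> h ` carrier M \<and> k \<in> ?K}" if x: "x \<in> carrier P" for x
  proof -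
    obtain y where y: "y \<in> carrier M" "\<pi> (h y) = \<pi> x" using onto[OF x] by blast
    let ?k = "\<ominus>\<^bsub>P\<^esub> h y \<oplus>\<^bsub>P\<^esub> x"
    have hy: "h y \<in> carrier P" using mod_homD(1)[OF h y(1)] .
    have "\<pi> (h y \<oplus>\<^bsub>P\<^esub> ?k) = \<pi> (h y) \<oplus>\<^bsub>V\<^esub> \<pi> ?k"
      using hy x by (intro mod_homD(2)[OF \<pi>]) auto
    moreover have eq: "h y \<oplus>\<^bsub>P\<^esub> ?k = x"
      using hy x by (simp add: P.r_neg2)
    ultimately have "\<pi> x = \<pi> x \<oplus>\<^bsub>V\<^esub> \<pi> ?k" using y by simp
    moreover have "\<pi> x \<in> carrier V" "\<pi> ?k \<in> carrier V"
      using hy x by (auto intro!: mod_homD(1)[OF \<pi>])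
    ultimately have "\<pi> ?k = \<zero>\<^bsub>V\<^esub>" using V.r_zero V.a_comm by simp
    moreover have "?k \<in> carrier P" using hy x by simp
    ultimately show ?thesis
      using eq y(1) by (intro CollectI exI[of _ "h y"] exI[of _ ?k]) simp
  qed
  moreover have "u \<oplus>\<^bsub>P\<^esub> k \<in> carrier P" if "u \<in> h ` carrier M" "k \<in> ?K" for u k
    using that mod_homD(1)[OF h] by auto
  ultimately have "{u \<oplus>\<^bsub>P\<^esub> k | u k. u \<in> h ` carrier M \<and> k \<in> ?K} = carrier P" by blast
  with sup left_submodule_image[OF M P h] show ?thesis unfolding superfluous_def by blast
qed

text \<open>
  The hypotheses on \<open>\<phi>\<close> and \<open>q\<close> say that \<open>Q\<close> is a direct summand of the regular module.
\<close>

lemma projective_cover_unique: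
  fixes P :: "('k::field um, 'p) module" and Q :: "('k um, 'q) module"
    and V :: "('k um, 'v) module"
  assumes cover: "projective_cover P V" and Q: "left_module Q" and V: "left_module V"
    and \<phi>: "\<phi> \<in> mod_hom Q regular" and q: "q \<in> carrier Q"
    and \<phi>_q: "\<And>x. x \<in> carrier Q \<Longrightarrow> \<phi> x \<odot>\<^bsub>Q\<^esub> q = x"
    and \<pi>': "\<pi>' \<in> mod_hom Q V" "\<pi>' ` carrier Q = carrier V"
    and sup': "superfluous {x \<in> carrier Q. \<pi>' x = \<zero>\<^bsub>V\<^esub>} Q"
  shows "P \<simeq> Q"
proof -
  obtain \<pi> where proj: "projective P" and \<pi>: "\<pi> \<in> mod_hom P V" "\<pi> ` carrier P = carrier V"
    and sup: "superfluous {x \<in> carrier P. \<pi> x = \<zero>\<^bsub>V\<^esub>} P"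
    using cover by (auto simp: projective_cover_def)
  have P: "left_module P" using proj by (simp add: projective_def)
  interpret P: left_module P by fact
  interpret Q: left_module Q by fact
  have "\<pi>' q \<in> \<pi> ` carrier P" using mod_homD(1)[OF \<pi>'(1) q] \<pi>(2) by simp
  then obtain m where m: "m \<in> carrier P" "\<pi> m = \<pi>' q" by auto
  \<comment> \<open>The lift of \<open>\<pi>'\<close> through \<open>\<pi>\<close>: sending
    \<open>q\<close> to a preimage \<open>m\<close> of its image extends to \<open>Q\<close> by
    means of the section \<open>\<phi>\<close>.\<close>
  define p where "p x = \<phi> x \<odot>\<^bsub>P\<^esub> m" for x
  have p: "p \<in> mod_hom Q P"
    using mod_hom_comp[OF \<phi> mod_hom_orbit[OF P m(1)]] by (simp add: p_def[abs_def] comp_def)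
  have \<pi>_p: "\<pi> (p x) = \<pi>' x" if x: "x \<in> carrier Q" for x
    using mod_homD(3)[OF \<pi>(1) m(1), of "\<phi> x"] mod_homD(3)[OF \<pi>'(1) q, of "\<phi> x"]
    by (simp add: p_def m(2) \<phi>_q[OF x])
  have p_onto: "p ` carrier Q = carrier P"
  proof (rule surj_of_superfluous_kernel[OF Q P V p \<pi>(1) sup])
    fix x assume "x \<in> carrier P"
    then have "\<pi> x \<in> \<pi>' ` carrier Q" using \<pi> \<pi>'(2) by blast
    then show "\<exists>y\<in>carrier Q. \<pi> (p y) = \<pi> x" using \<pi>_p by force
  qed
  have pq: "p q \<in> carrier P" using mod_homD(1)[OF p q] .
  have p_smult: "p (r \<odot>\<^bsub>Q\<^esub> q) = r \<odot>\<^bsub>P\<^esub> p q" for r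
    by (rule mod_homD(3)[OF p q])
  \<comment> \<open>As \<open>p\<close> is onto, \<open>P\<close> is generated by
    \<open>p q\<close>; now the splitting of cyclic projectives applies and yields a right inverse
    \<open>t\<close> of \<open>p\<close>.\<close>
  have "\<exists>r. r \<odot>\<^bsub>P\<^esub> p q = x" if "x \<in> carrier P" for x
    using that p_onto \<phi>_q p_smult by (metis imageE)
  from projective_cyclic_section[OF proj pq this] obtain s
    where s: "s \<in> mod_hom P regular" "\<And>x. x \<in> carrier P \<Longrightarrow> s x \<odot>\<^bsub>P\<^esub> p q = x" by blast
  define t where "t x = s x \<odot>\<^bsub>Q\<^esub> q" for x
  have t: "t \<in> mod_hom P Q"
    using mod_hom_comp[OF s(1) mod_hom_orbit[OF Q q]] by (simp add: t_def[abs_def] comp_def)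
  have p_t: "p (t x) = x" if "x \<in> carrier P" for x
    using s(2)[OF that] p_smult by (simp add: t_def)
  \<comment> \<open>Since \<open>\<pi>'\<close> is \<open>\<pi>\<close> after \<open>p\<close>, the
    elements \<open>t (p x)\<close> and \<open>x\<close> have the same image in \<open>V\<close>. So
    the image of \<open>t\<close> and the kernel of \<open>\<pi>'\<close> span \<open>Q\<close>;
    injectivity comes from \<open>p_t\<close>.\<close>
  have "t ` carrier P = carrier Q"
  proof (rule surj_of_superfluous_kernel[OF P Q V t \<pi>'(1) sup'])
    fix x assume x: "x \<in> carrier Q"
    have px: "p x \<in> carrier P" using mod_homD(1)[OF p x] .
    have "\<pi>' (t (p x)) = \<pi>' x"
      using \<pi>_p[OF mod_homD(1)[OF t px]] by (simp add: p_t[OF px] \<pi>_p[OF x])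
    with px show "\<exists>y\<in>carrier P. \<pi>' (t y) = \<pi>' x" by blast
  qed
  moreover have "inj_on t (carrier P)" using p_t by (metis inj_onI)
  ultimately show ?thesis using t unfolding mod_iso_def bij_betw_def by blast
qed

text \<open>A substitute for Nakayama's lemma at a cyclic generator. If \<open>U\<close> and the
  kernel span \<open>M\<close>, then some \<open>u\<close> in \<open>U\<close> has the same image as
  \<open>q\<close>; \<open>lift\<close> brings \<open>q\<close> into \<open>U\<close>, and
  \<open>q\<close> generates \<open>M\<close>.\<close>

lemma superfluous_kernelI:
  assumes M: "left_module M" and V: "left_module V" and \<pi>: "\<pi> \<in> mod_hom M V" and q: "q \<in> carrier M"
    and cyclic: "\<And>x. x \<in> carrier M \<Longrightarrow> \<exists>r. r \<odot>\<^bsub>M\<^esub> q = x"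
    and lift: "\<And>u. u \<in> carrier M \<Longrightarrow> \<pi> u = \<pi> q \<Longrightarrow> \<exists>r. r \<odot>\<^bsub>M\<^esub> u = q"
  shows "superfluous {x \<in> carrier M. \<pi> x = \<zero>\<^bsub>V\<^esub>} M"
proof -
  interpret M: left_module M by fact
  interpret V: left_module V by fact
  note \<pi> = mod_homD[OF \<pi>] mod_hom_zero[OF M V \<pi>]
  let ?K = "{x \<in> carrier M. \<pi> x = \<zero>\<^bsub>V\<^esub>}"
  have smult_zero: "r \<odot>\<^bsub>V\<^esub> \<zero>\<^bsub>V\<^esub> = \<zero>\<^bsub>V\<^esub>" for r
    using V.smult_r_distr[of "\<zero>\<^bsub>V\<^esub>" "\<zero>\<^bsub>V\<^esub>" r] V.smult_closed[of "\<zero>\<^bsub>V\<^esub>" r] by simp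
  have "left_submodule ?K M"
    unfolding left_submodule_def by (auto simp: \<pi> M.smult_closed smult_zero)
  moreover have "U = carrier M"
    if U: "left_submodule U M" and sum: "{u \<oplus>\<^bsub>M\<^esub> x | u x. u \<in> U \<and> x \<in> ?K} = carrier M" for U
  proof -
    have sub: "U \<subseteq> carrier M" and smult: "u \<in> U \<Longrightarrow> r \<odot>\<^bsub>M\<^esub> u \<in> U" for r u
      using U by (auto simp: left_submodule_def)
    from q sum obtain u x where u: "u \<in> U" "x \<in> ?K" "q = u \<oplus>\<^bsub>M\<^esub> x" by blast
    have "\<pi> q = \<pi> u"
      using u sub by (auto simp: \<pi> subset_iff)
    then obtain r where "r \<odot>\<^bsub>M\<^esub> u = q" using lift[of u] u(1) sub by auto
    then have "q \<in> U" using smult[OF u(1)] by metis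
    have "x \<in> U" if x: "x \<in> carrier M" for x
      using cyclic[OF x] smult[OF \<open>q \<in> U\<close>] by metis
    with sub show ?thesis by blast
  qed
  ultimately show ?thesis unfolding superfluous_def by blast
qed

section \<open>Isomorphisms out of tensor products\<close>

lemma abs_um2_comult_scalar:
  assumes "CHAR('k::field) = 2"
  shows "comult (um_scalar c) = abs_um2 (Poly_Mapping.single (1, 1) (c :: 'k))"
  by (simp add: comult_hom[OF assms] um2_scalar_def)

lemma abs_um2_comult_gen:
  assumes "CHAR('k::field) = 2"
  shows "comult (um_gen g) =
    abs_um2 (Poly_Mapping.single (um_gen g, 1) (1 :: 'k) + Poly_Mapping.single (1, um_gen g) 1)"
  by (simp add: comult_primitive[OF assms] um2_pure_def plus_um2.abs_eq)

text \<open>A map whose fibres are the cosets of \<open>tensor_null\<close> descends injectively to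
  classes. Equivariance is asked only for scalars and generators, because their comultiplication is
  an explicit formal sum.\<close>

lemma tensor_mod_isoI:
  fixes M :: "('k::field um, 'v) module" and N :: "('k um, 'w) module" and D :: "('k um, 'd) module"
  defines "C \<equiv> {f :: 'v \<times> 'w \<Rightarrow>\<^sub>0 'k. Poly_Mapping.keys f \<subseteq> carrier M \<times> carrier N}"
  assumes char: "CHAR('k) = 2" and M: "left_module M" and N: "left_module N" and D: "left_module D"
    and onto: "\<Lambda> ` C = carrier D"
    and add: "\<And>f g. f \<in> C \<Longrightarrow> g \<in> C \<Longrightarrow> \<Lambda> (f + g) = \<Lambda> f \<oplus>\<^bsub>D\<^esub> \<Lambda> g"
    and eq_iff: "\<And>f g. f \<in> C \<Longrightarrow> g \<in> C \<Longrightarrow> \<Lambda> f = \<Lambda> g \<longleftrightarrow> f - g \<in> tensor_null M N"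
    and scalar: "\<And>f c. f \<in> C \<Longrightarrow>
      \<Lambda> (tensor_act M N (Poly_Mapping.single (1, 1) c) f) = um_scalar c \<odot>\<^bsub>D\<^esub> \<Lambda> f"
    and gen: "\<And>f g. f \<in> C \<Longrightarrow>
      \<Lambda> (tensor_act M N (Poly_Mapping.single (um_gen g, 1) 1 + Poly_Mapping.single (1, um_gen g) 1) f)
        = um_gen g \<odot>\<^bsub>D\<^esub> \<Lambda> f"
  shows "M \<otimes>\<^sub>m N \<simeq> D"
proof -
  let ?t = "tensor_class M N"
  have car: "carrier (M \<otimes>\<^sub>m N) = ?t ` C"
    by (simp add: tensor_module_def C_def)
  have plus: "f + g \<in> C" if "f \<in> C" "g \<in> C" for f g
    using that keys_add[of f g] by (auto simp: C_def)
  have act: "tensor_act M N F f \<in> C" if "f \<in> C" for F f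
    using that keys_tensor_act[OF M N] by (simp add: C_def)
  have smult: "x \<odot>\<^bsub>M \<otimes>\<^sub>m N\<^esub> ?t f = ?t (tensor_act M N F f)"
    if "f \<in> C" "comult x = abs_um2 F" for x F f
    using tensor_module_smult[OF M N _ that(2)] that(1) by (simp add: C_def)
  \<comment> \<open>By \<open>eq_iff\<close> the value does not depend on the representative chosen
    in \<open>C\<close>.\<close>
  define H where "H S = \<Lambda> (SOME f. f \<in> C \<and> S = ?t f)" for S
  have H: "H (?t f) = \<Lambda> f" if f: "f \<in> C" for f
  proof -
    have "(SOME f'. f' \<in> C \<and> ?t f = ?t f') \<in> C \<and> ?t f = ?t (SOME f'. f' \<in> C \<and> ?t f = ?t f')"
      by (rule someI[of _ f]) (simp add: f)
    then show ?thesis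
      unfolding H_def using eq_iff f tensor_class_eq_iff by metis
  qed
  have "H \<in> mod_hom (M \<otimes>\<^sub>m N) D"
  proof (rule mod_hom_gensI[OF left_module_tensor[OF char M N] D])
    fix S assume "S \<in> carrier (M \<otimes>\<^sub>m N)"
    then obtain f where f: "f \<in> C" "S = ?t f" unfolding car by blast
    show "H S \<in> carrier D"
      unfolding f(2) H[OF f(1)] using onto f(1) by blast
    show "H (um_scalar c \<odot>\<^bsub>M \<otimes>\<^sub>m N\<^esub> S) = um_scalar c \<odot>\<^bsub>D\<^esub> H S" for c
      unfolding f(2) smult[OF f(1) abs_um2_comult_scalar[OF char]] H[OF act[OF f(1)]] H[OF f(1)]
      by (rule scalar[OF f(1)])
    show "H (um_gen g \<odot>\<^bsub>M \<otimes>\<^sub>m N\<^esub> S) = um_gen g \<odot>\<^bsub>D\<^esub> H S" for g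
      unfolding f(2) smult[OF f(1) abs_um2_comult_gen[OF char]] H[OF act[OF f(1)]] H[OF f(1)]
      by (rule gen[OF f(1)])
    fix T assume "T \<in> carrier (M \<otimes>\<^sub>m N)"
    then obtain g where g: "g \<in> C" "T = ?t g" unfolding car by blast
    show "H (S \<oplus>\<^bsub>M \<otimes>\<^sub>m N\<^esub> T) = H S \<oplus>\<^bsub>D\<^esub> H T"
      unfolding f(2) g(2) tensor_module_add H[OF plus[OF f(1) g(1)]] H[OF f(1)] H[OF g(1)]
      by (rule add[OF f(1) g(1)])
  qed
  moreover have "inj_on H (carrier (M \<otimes>\<^sub>m N))"
  proof (rule inj_onI)
    fix S T assume "S \<in> carrier (M \<otimes>\<^sub>m N)" "T \<in> carrier (M \<otimes>\<^sub>m N)" and HST: "H S = H T"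
    then obtain f g where f: "f \<in> C" "S = ?t f" and g: "g \<in> C" "T = ?t g" unfolding car by blast
    from HST have "\<Lambda> f = \<Lambda> g" unfolding f(2) g(2) H[OF f(1)] H[OF g(1)] .
    then show "S = T" unfolding f(2) g(2) tensor_class_eq_iff eq_iff[OF f(1) g(1)] .
  qed
  moreover have "H ` carrier (M \<otimes>\<^sub>m N) = carrier D"
    unfolding car onto[symmetric] image_image by (rule image_cong) (simp_all add: H)
  ultimately show ?thesis unfolding mod_iso_def bij_betw_def by blast
qed

section \<open>Functoriality of the tensor product in its left factor\<close>

definition map_left :: "('v \<Rightarrow> 'v') \<Rightarrow> ('v \<times> 'w \<Rightarrow>\<^sub>0 'k::field) \<Rightarrow> ('v' \<times> 'w \<Rightarrow>\<^sub>0 'k)" where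
  "map_left h = lin_ext (\<lambda>(m, n) c. Poly_Mapping.single (h m, n) c)"

lemma map_left_single: "map_left h (Poly_Mapping.single (m, n) c) = Poly_Mapping.single (h m, n) c"
  unfolding map_left_def by (subst lin_ext_single) auto

lemma map_left_add: "map_left h (f + g) = map_left h f + map_left h g"
  unfolding map_left_def by (rule lin_ext_add) (auto simp: single_add)

lemma map_left_diff: "map_left h (f - g) = map_left h f - map_left h g"
  unfolding map_left_def by (rule lin_ext_diff) (auto simp: single_add)

lemma map_left_zero [simp]: "map_left h 0 = 0"
  by (simp add: map_left_def)

lemma map_left_null:
  assumes h: "h \<in> mod_hom M M'" and f: "f \<in> tensor_null M N"
  shows "map_left h f \<in> tensor_null M' N"
  using f
  by (induction rule: tensor_null.induct)
    (simp_all add: map_left_diff map_left_single mod_homD[OF h] tensor_null.intros)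

lemma keys_map_left:
  assumes h: "h \<in> mod_hom M M'" and f: "Poly_Mapping.keys f \<subseteq> carrier M \<times> carrier N"
  shows "Poly_Mapping.keys (map_left h f) \<subseteq> carrier M' \<times> carrier N"
  using f
proof (induction f rule: poly_mapping_keys_induct)
  case (single p c)
  then show ?case
    using mod_homD(1)[OF h] by (cases p) (auto simp: map_left_single split: if_splits)
next
  case (add f g)
  then show ?case
    unfolding map_left_add using keys_add by (meson Un_least subset_trans)
qed simp

lemma map_left_act:
  assumes h: "h \<in> mod_hom M M'" and f: "Poly_Mapping.keys f \<subseteq> carrier M \<times> carrier N"
  shows "map_left h (tensor_act M N F f) = tensor_act M' N F (map_left h f)"
proof (induction F rule: poly_mapping_add_induct)
  case (single p c)
  obtain x y where p: "p = (x, y)" by force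
  from f show ?case
    by (induction f rule: poly_mapping_keys_induct)
      (auto simp: p tensor_act_single map_left_single mod_homD[OF h] tensor_act_add_right map_left_add)
qed (simp_all add: tensor_act_add_left map_left_add)

lemma map_left_inverse:
  assumes "\<And>x. x \<in> carrier M \<Longrightarrow> h' (h x) = x"
    and f: "Poly_Mapping.keys f \<subseteq> carrier M \<times> carrier N"
  shows "map_left h' (map_left h f) = f"
  using f
  by (induction f rule: poly_mapping_keys_induct)
    (auto simp: map_left_single map_left_add assms(1))

text \<open>This moves the abstract covers, which are left tensor factors, to the models.
  Injectivity on classes holds because \<open>map_left h'\<close> carries null sums back to null
  sums.\<close>

lemma tensor_mod_iso_left:
  fixes M :: "('k::field um, 'v) module" and M' :: "('k um, 'v') module" and N :: "('k um, 'w) module"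
  assumes char: "CHAR('k) = 2" and M: "left_module M" and M': "left_module M'"
    and N: "left_module N" and iso: "M \<simeq> M'"
  shows "M \<otimes>\<^sub>m N \<simeq> M' \<otimes>\<^sub>m N"
proof -
  obtain h h' where h: "h \<in> mod_hom M M'" and h': "h' \<in> mod_hom M' M"
    and inv: "\<And>x. x \<in> carrier M \<Longrightarrow> h' (h x) = x" and inv': "\<And>y. y \<in> carrier M' \<Longrightarrow> h (h' y) = y"
    using mod_isoE[OF M iso] by metis
  let ?\<Lambda> = "\<lambda>f. tensor_class M' N (map_left h f)"
  show ?thesis
  proof (rule tensor_mod_isoI[where \<Lambda> = ?\<Lambda>, OF char M N left_module_tensor[OF char M' N]])
    let ?C = "{f :: 'v \<times> 'w \<Rightarrow>\<^sub>0 'k. Poly_Mapping.keys f \<subseteq> carrier M \<times> carrier N}"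
    let ?C' = "{f :: 'v' \<times> 'w \<Rightarrow>\<^sub>0 'k. Poly_Mapping.keys f \<subseteq> carrier M' \<times> carrier N}"
    have "map_left h ` ?C = ?C'"
    proof
      show "map_left h ` ?C \<subseteq> ?C'" using keys_map_left[OF h] by blast
      show "?C' \<subseteq> map_left h ` ?C"
      proof
        fix f assume f: "f \<in> ?C'"
        then have "map_left h' f \<in> ?C" using keys_map_left[OF h'] by blast
        moreover have "f = map_left h (map_left h' f)"
          using map_left_inverse[of M' h h' f N] inv' f by simp
        ultimately show "f \<in> map_left h ` ?C" by blast
      qed
    qed
    then have "tensor_class M' N ` (map_left h ` ?C) = carrier (M' \<otimes>\<^sub>m N)"
      by (simp add: tensor_module_def)
    then show "?\<Lambda> ` ?C = carrier (M' \<otimes>\<^sub>m N)"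
      by (simp add: image_image)
    fix f assume f: "f \<in> ?C"
    then have f': "Poly_Mapping.keys f \<subseteq> carrier M \<times> carrier N" by simp
    note smult = tensor_module_smult[OF M' N keys_map_left[OF h f']]
    show "?\<Lambda> (tensor_act M N (Poly_Mapping.single (1, 1) c) f) = um_scalar c \<odot>\<^bsub>M' \<otimes>\<^sub>m N\<^esub> ?\<Lambda> f" for c
      unfolding smult[OF abs_um2_comult_scalar[OF char]] map_left_act[OF h f'] ..
    show "?\<Lambda> (tensor_act M N (Poly_Mapping.single (um_gen g, 1) 1 + Poly_Mapping.single (1, um_gen g) 1) f)
        = um_gen g \<odot>\<^bsub>M' \<otimes>\<^sub>m N\<^esub> ?\<Lambda> f" for g
      unfolding smult[OF abs_um2_comult_gen[OF char]] map_left_act[OF h f'] ..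
    fix g assume g: "g \<in> ?C"
    then have g': "Poly_Mapping.keys g \<subseteq> carrier M \<times> carrier N" by simp
    show "?\<Lambda> (f + g) = ?\<Lambda> f \<oplus>\<^bsub>M' \<otimes>\<^sub>m N\<^esub> ?\<Lambda> g"
      by (simp add: tensor_module_add map_left_add)
    have "f - g \<in> tensor_null M N" if "map_left h (f - g) \<in> tensor_null M' N"
    proof -
      have "map_left h' (map_left h (f - g)) = f - g"
        using map_left_inverse[of M h' h _ N, OF inv f'] map_left_inverse[of M h' h _ N, OF inv g']
        by (simp add: map_left_diff)
      then show ?thesis using map_left_null[OF h' that] by simp
    qed
    then show "?\<Lambda> f = ?\<Lambda> g \<longleftrightarrow> f - g \<in> tensor_null M N"
      using map_left_null[OF h] by (auto simp: tensor_class_eq_iff map_left_diff[symmetric])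
  qed
qed

section \<open>Modules given by operators on a vector space\<close>

lemma um_scalar_zero: "um_scalar 0 = (0 :: 'k::field um)"
  using um_scalar_add[of 0 "0 :: 'k"] by simp

lemma gen_module_simps [simp]:
  "carrier (gen_module scale \<rho>) = UNIV" "\<zero>\<^bsub>gen_module scale \<rho>\<^esub> = 0" "add (gen_module scale \<rho>) = (+)"
  by (simp_all add: gen_module_def)

text \<open>The six relators generate \<open>um_ideal\<close>, so six operator identities let the
  action of the free algebra descend; afterwards generators and scalars act by explicit
  formulas.\<close>

lemma gen_module_props:
  fixes scale :: "'k::field \<Rightarrow> 'v::ab_group_add \<Rightarrow> 'v"
  assumes vs: "vector_space scale"
    and add: "\<And>g x y. \<rho> g (x + y) = \<rho> g x + \<rho> g y"
    and scale: "\<And>g c x. \<rho> g (scale c x) = scale c (\<rho> g x)"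
    and rels: "\<And>v. \<rho> GenA (\<rho> GenB v) + \<rho> GenB (\<rho> GenA v) = \<rho> GenC v"
      "\<And>v. \<rho> GenA (\<rho> GenC v) + \<rho> GenC (\<rho> GenA v) = \<rho> GenA v"
      "\<And>v. \<rho> GenB (\<rho> GenC v) + \<rho> GenC (\<rho> GenB v) = \<rho> GenB v"
      "\<And>v. \<rho> GenA (\<rho> GenA (\<rho> GenA (\<rho> GenA v))) = 0"
      "\<And>v. \<rho> GenB (\<rho> GenB (\<rho> GenB (\<rho> GenB v))) = 0"
      "\<And>v. \<rho> GenC (\<rho> GenC v) + \<rho> GenC v = 0"
  shows "left_module (gen_module scale \<rho>)"
    and "um_gen g \<odot>\<^bsub>gen_module scale \<rho>\<^esub> v = \<rho> g v"
    and "um_scalar c \<odot>\<^bsub>gen_module scale \<rho>\<^esub> v = scale c v"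
proof -
  note lin = vs add scale
  have act_rels: "free_act scale \<rho> r v = 0" if "r \<in> um_relations" for r v
    using that by (auto simp: um_relations_def Let_def free_act_add[where \<rho> = \<rho>, OF lin]
        free_act_diff[where \<rho> = \<rho>, OF lin] free_act_mult[where \<rho> = \<rho>, OF lin]
        free_act_gen[where \<rho> = \<rho>, OF lin] power2_eq_square power4_eq_xxxx rels)
  show "left_module (gen_module scale \<rho>)"
    by (rule left_module_gen_module[where \<rho> = \<rho>, OF lin act_rels])
  show "um_gen g \<odot>\<^bsub>gen_module scale \<rho>\<^esub> v = \<rho> g v"
    by (rule gen_module_gen[where \<rho> = \<rho>, OF lin act_rels])
  have "abs_um (Poly_Mapping.single 0 c) \<odot>\<^bsub>gen_module scale \<rho>\<^esub> v =
      free_act scale \<rho> (Poly_Mapping.single 0 c) v"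
    by (rule gen_module_smult[where \<rho> = \<rho>, OF lin act_rels])
  then show "um_scalar c \<odot>\<^bsub>gen_module scale \<rho>\<^esub> v = scale c v"
    by (simp add: um_scalar_def free_act_single[where \<rho> = \<rho>, OF lin]) (simp add: zero_word_def)
qed

text \<open>The second equation cancels equal summands in front of a remaining sum, which a sorted
  sum requires.\<close>

lemma double_eq_zero:
  assumes "CHAR('k::ring_1) = 2"
  shows "x + x = (0 :: 'k)" "x + (x + y) = y"
proof -
  have "(1 :: 'k) + 1 = 0"
    using of_nat_CHAR[where 'a = 'k] assms by simp
  then show *: "x + x = 0" for x :: 'k
    by (metis distrib_right mult_1 mult_zero_left)
  show "x + (x + y) = y"
    by (simp add: add.assoc[symmetric] *)
qed

section \<open>Tensor products with \<open>V\<^sub>1\<close>\<close>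

definition V1_coords ::
    "('k::field um, 'v::ab_group_add) module \<Rightarrow> ('v \<times> 'k \<times> 'k \<times> 'k \<Rightarrow>\<^sub>0 'k) \<Rightarrow> 'v \<times> 'v \<times> 'v" where
  "V1_coords Q = lin_ext (\<lambda>(m, x, y, z) d.
     (um_scalar (d * x) \<odot>\<^bsub>Q\<^esub> m, um_scalar (d * y) \<odot>\<^bsub>Q\<^esub> m, um_scalar (d * z) \<odot>\<^bsub>Q\<^esub> m))"

text \<open>Inverse to \<open>V1_coords\<close> only modulo \<open>tensor_null\<close>: as a map to
  formal sums it is not additive, and its value at 0 is not 0.\<close>

definition V1_tensor :: "'v \<times> 'v \<times> 'v \<Rightarrow> ('v \<times> 'k::field \<times> 'k \<times> 'k \<Rightarrow>\<^sub>0 'k)" where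
  "V1_tensor = (\<lambda>(m1, m2, m3). Poly_Mapping.single (m1, 1, 0, 0) 1
     + Poly_Mapping.single (m2, 0, 1, 0) 1 + Poly_Mapping.single (m3, 0, 0, 1) 1)"

lemma um_scalar_smult_V1:
  "um_scalar c \<odot>\<^bsub>V1\<^esub> (v :: 'k \<times> 'k \<times> 'k) = scale3 (c :: 'k::field) v" if char: "CHAR('k) = 2"
proof -
  have vs: "vector_space (scale3 :: 'k \<Rightarrow> _)"
    by standard (auto simp: algebra_simps)
  have "V1_gen g (x + y) = V1_gen g x + V1_gen g y" "V1_gen g (scale3 d x) = scale3 d (V1_gen g x)"
    for g d and x y :: "'k \<times> 'k \<times> 'k"
    by (cases g; cases x; cases y; simp)+
  then show ?thesis
    unfolding V1_def
    by (rule gen_module_props(3)[where \<rho> = V1_gen, OF vs])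
      (auto simp: double_eq_zero[OF char] zero_prod_def)
qed

context
  fixes Q :: "('k::field um, 'v::ab_group_add) module"
  assumes char: "CHAR('k) = 2" and Q: "left_module Q"
    and carrier: "carrier Q = UNIV" and add: "add Q = (+)"
begin

interpretation Q: left_module Q by (rule Q)

lemma UNIV_module_smult:
  "(x + y) \<odot>\<^bsub>Q\<^esub> m = x \<odot>\<^bsub>Q\<^esub> m + y \<odot>\<^bsub>Q\<^esub> m" "x \<odot>\<^bsub>Q\<^esub> (m + n) = x \<odot>\<^bsub>Q\<^esub> m + x \<odot>\<^bsub>Q\<^esub> n"
  "(x * y) \<odot>\<^bsub>Q\<^esub> m = x \<odot>\<^bsub>Q\<^esub> (y \<odot>\<^bsub>Q\<^esub> m)" "1 \<odot>\<^bsub>Q\<^esub> m = m"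
  "0 \<odot>\<^bsub>Q\<^esub> m = 0" "x \<odot>\<^bsub>Q\<^esub> 0 = 0"
proof -
  show *: "(x + y) \<odot>\<^bsub>Q\<^esub> m = x \<odot>\<^bsub>Q\<^esub> m + y \<odot>\<^bsub>Q\<^esub> m" "x \<odot>\<^bsub>Q\<^esub> (m + n) = x \<odot>\<^bsub>Q\<^esub> m + x \<odot>\<^bsub>Q\<^esub> n" for x y m n
    using Q.smult_l_distr[of m x y] Q.smult_r_distr[of m n x] by (simp_all add: carrier add)
  show "(x * y) \<odot>\<^bsub>Q\<^esub> m = x \<odot>\<^bsub>Q\<^esub> (y \<odot>\<^bsub>Q\<^esub> m)" "1 \<odot>\<^bsub>Q\<^esub> m = m"
    using Q.smult_assoc Q.smult_one by (simp_all add: carrier)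
  show "0 \<odot>\<^bsub>Q\<^esub> m = 0" "x \<odot>\<^bsub>Q\<^esub> 0 = 0"
    using *(1)[of 0 0 m] *(2)[of x 0 0] by simp_all
qed

lemma V1_coords_single: "V1_coords Q (Poly_Mapping.single (m, x, y, z) d) =
    (um_scalar (d * x) \<odot>\<^bsub>Q\<^esub> m, um_scalar (d * y) \<odot>\<^bsub>Q\<^esub> m, um_scalar (d * z) \<odot>\<^bsub>Q\<^esub> m)"
  unfolding V1_coords_def
  by (subst lin_ext_single) (auto simp: um_scalar_zero UNIV_module_smult zero_prod_def)

lemma V1_coords_add: "V1_coords Q (f + g) = V1_coords Q f + V1_coords Q g"
  unfolding V1_coords_def
  by (rule lin_ext_add)
    (auto simp: um_scalar_zero UNIV_module_smult zero_prod_def um_scalar_add distrib_right)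

lemma V1_coords_diff: "V1_coords Q (f - g) = V1_coords Q f - V1_coords Q g"
  using V1_coords_add[of "f - g" g] by (simp add: eq_diff_eq)

lemma V1_coords_zero: "V1_coords Q 0 = 0"
  by (simp add: V1_coords_def)

lemma V1_coords_null: "f \<in> tensor_null Q V1 \<Longrightarrow> V1_coords Q f = 0"
proof (induction rule: tensor_null.induct)
  case (add_left m m' n c)
  then show ?case
    by (cases n) (simp add: V1_coords_diff V1_coords_single add UNIV_module_smult zero_prod_def)
next
  case (add_right m n n' c)
  have "n \<oplus>\<^bsub>V1\<^esub> n' = n + n'" by (simp add: V1_def gen_module_def)
  then show ?case
    by (cases n; cases n')
      (simp add: V1_coords_diff V1_coords_single um_scalar_add distrib_left UNIV_module_smult zero_prod_def)
next
  case (scale_left m n d c)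
  then show ?case
    by (cases n)
      (simp add: V1_coords_diff V1_coords_single UNIV_module_smult(3)[symmetric] um_scalar_mult[symmetric]
        zero_prod_def mult_ac)
next
  case (scale_right m n d c)
  then show ?case
    by (cases n)
      (simp add: V1_coords_diff V1_coords_single um_scalar_smult_V1[OF char] zero_prod_def mult_ac)
qed (simp_all add: V1_coords_zero V1_coords_diff)

lemma V1_tensor_add:
  "V1_tensor (t + t') - V1_tensor t - V1_tensor t' \<in> tensor_null Q V1"
proof -
  obtain m1 m2 m3 n1 n2 n3 where t: "t = (m1, m2, m3)" "t' = (n1, n2, n3)"
    by (metis prod_cases3)
  let ?d = "\<lambda>m n v. Poly_Mapping.single (m + n, v) 1 - Poly_Mapping.single (m, v) 1
    - Poly_Mapping.single (n, v) (1 :: 'k)"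
  have "?d m n v \<in> tensor_null Q V1" for m n v
    using tensor_null.add_left[of m Q n v V1 1] by (simp add: carrier add V1_def gen_module_def)
  then have "?d m1 n1 (1, 0, 0) + ?d m2 n2 (0, 1, 0) + ?d m3 n3 (0, 0, 1) \<in> tensor_null Q V1"
    by (intro tensor_null_add)
  then show ?thesis
    by (simp add: t V1_tensor_def algebra_simps)
qed

lemma V1_tensor_coords: "f - V1_tensor (V1_coords Q f) \<in> tensor_null Q V1"
proof (induction f rule: poly_mapping_add_induct)
  case zero
  \<comment> \<open>Additivity modulo null sums, at 0 + 0, leaves minus
    \<open>V1_tensor 0\<close>.\<close>
  have "V1_tensor (0 :: 'v \<times> 'v \<times> 'v) \<in> tensor_null Q V1"
    using tensor_null_minus[OF V1_tensor_add[of 0 0]] by simp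
  then show ?case using tensor_null_minus by (fastforce simp: V1_coords_zero)
next
  case (single p d)
  obtain m x y z where p: "p = (m, x, y, z)" by (metis prod_cases4)
  have V1: "carrier V1 = (UNIV :: ('k \<times> 'k \<times> 'k) set)" "n \<oplus>\<^bsub>V1\<^esub> n' = n + n'"
    for n n' :: "'k \<times> 'k \<times> 'k"
    by (simp_all add: V1_def gen_module_def)
  let ?s = "\<lambda>n c. Poly_Mapping.single (m, n) c :: 'v \<times> 'k \<times> 'k \<times> 'k \<Rightarrow>\<^sub>0 'k"
  let ?e1 = "(1, 0, 0) :: 'k \<times> 'k \<times> 'k" and ?e2 = "(0, 1, 0) :: 'k \<times> 'k \<times> 'k"
    and ?e3 = "(0, 0, 1) :: 'k \<times> 'k \<times> 'k"
  have add: "?s (n + n') d - ?s n d - ?s n' d \<in> tensor_null Q V1" for n n'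
    using tensor_null.add_right[of m Q n V1 n' d] by (simp add: carrier V1)
  \<comment> \<open>\<open>scale_right\<close> takes \<open>c\<close> out of the right factor;
    \<open>scale_left\<close> then absorbs the whole coefficient \<open>d * c\<close> into
    \<open>m\<close>.\<close>
  have scale: "?s (scale3 c n) d - Poly_Mapping.single (um_scalar (d * c) \<odot>\<^bsub>Q\<^esub> m, n) 1 \<in> tensor_null Q V1"
    for c n
    using tensor_null.diff[OF tensor_null.scale_right[of m Q n V1 c d]
        tensor_null.scale_left[of m Q n V1 "d * c" 1]]
    by (simp add: carrier V1 um_scalar_smult_V1[OF char] mult_ac)
  have xyz: "(x, y, z) = (scale3 x ?e1 + scale3 y ?e2) + scale3 z ?e3" by simp
  \<comment> \<open>A telescoping sum: split off the third basis vector, then separate the first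
    two, then move the three scalars to the left factor.\<close>
  have "(?s ((scale3 x ?e1 + scale3 y ?e2) + scale3 z ?e3) d
        - ?s (scale3 x ?e1 + scale3 y ?e2) d - ?s (scale3 z ?e3) d)
      + (?s (scale3 x ?e1 + scale3 y ?e2) d - ?s (scale3 x ?e1) d - ?s (scale3 y ?e2) d)
      + (?s (scale3 x ?e1) d - Poly_Mapping.single (um_scalar (d * x) \<odot>\<^bsub>Q\<^esub> m, ?e1) 1)
      + (?s (scale3 y ?e2) d - Poly_Mapping.single (um_scalar (d * y) \<odot>\<^bsub>Q\<^esub> m, ?e2) 1)
      + (?s (scale3 z ?e3) d - Poly_Mapping.single (um_scalar (d * z) \<odot>\<^bsub>Q\<^esub> m, ?e3) 1)
      \<in> tensor_null Q V1"
    by (intro tensor_null_add add scale)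
  then have "?s (x, y, z) d - (Poly_Mapping.single (um_scalar (d * x) \<odot>\<^bsub>Q\<^esub> m, ?e1) 1
      + Poly_Mapping.single (um_scalar (d * y) \<odot>\<^bsub>Q\<^esub> m, ?e2) 1
      + Poly_Mapping.single (um_scalar (d * z) \<odot>\<^bsub>Q\<^esub> m, ?e3) 1) \<in> tensor_null Q V1"
    unfolding xyz by (simp only: diff_diff_eq add_diff_eq diff_add_eq diff_eq_eq eq_diff_eq) (simp add: algebra_simps)
  then show ?case
    by (simp only: p V1_coords_single V1_tensor_def prod.case)
next
  case (add f g)
  from tensor_null.diff[OF tensor_null_add[OF add] V1_tensor_add[of "V1_coords Q f" "V1_coords Q g"]]
  show ?case by (simp add: V1_coords_add algebra_simps)
qed

lemma V1_coords_tensor: "V1_coords Q (V1_tensor t) = t"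
  by (cases t) (simp add: V1_tensor_def V1_coords_add V1_coords_single um_scalar_one um_scalar_zero
      UNIV_module_smult zero_prod_def)

lemma V1_coords_act_scalar:
  "V1_coords Q (tensor_act Q V1 (Poly_Mapping.single (1, 1) c) f) =
    map_prod (smult Q (um_scalar c)) (map_prod (smult Q (um_scalar c)) (smult Q (um_scalar c)))
      (V1_coords Q f)"
proof (induction f rule: poly_mapping_add_induct)
  case (single p d)
  obtain m x y z where p: "p = (m, x, y, z)" by (metis prod_cases4)
  have "1 \<odot>\<^bsub>V1\<^esub> (x, y, z) = (x, y, z)"
    using left_module.smult_one[OF V1_module(1)[OF char]] by (simp add: V1_def)
  then show ?case
    by (simp add: p tensor_act_single V1_coords_single UNIV_module_smult um_scalar_mult mult.assoc)
next
  case (add f g)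
  then show ?case
    by (cases "V1_coords Q f"; cases "V1_coords Q g")
      (simp add: tensor_act_add_right V1_coords_add UNIV_module_smult)
qed (simp add: V1_coords_zero zero_prod_def UNIV_module_smult)

text \<open>A primitive element acts as g \<otimes> 1 + 1 \<otimes> g. The matrix of g on V_1 has
  entries 0 and 1, so \<open>V1_gen\<close> itself, applied to a triple of elements of
  \<open>Q\<close>, gives the second summand.\<close>

lemma V1_coords_act_gen:
  "V1_coords Q (tensor_act Q V1
      (Poly_Mapping.single (um_gen g, 1) 1 + Poly_Mapping.single (1, um_gen g) 1) f) =
    map_prod (smult Q (um_gen g)) (map_prod (smult Q (um_gen g)) (smult Q (um_gen g)))
      (V1_coords Q f) + V1_gen g (V1_coords Q f)"
proof (induction f rule: poly_mapping_add_induct)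
  case (single p d)
  obtain m x y z where p: "p = (m, x, y, z)" by (metis prod_cases4)
  have "1 \<odot>\<^bsub>V1\<^esub> (x, y, z) = (x, y, z)"
    using left_module.smult_one[OF V1_module(1)[OF char]] by (simp add: V1_def)
  moreover have "um_gen g \<odot>\<^bsub>Q\<^esub> (um_scalar c \<odot>\<^bsub>Q\<^esub> m) = um_scalar c \<odot>\<^bsub>Q\<^esub> (um_gen g \<odot>\<^bsub>Q\<^esub> m)" for c
    by (metis UNIV_module_smult(3) um_scalar_central)
  ultimately show ?case
    by (cases g)
      (simp_all add: p tensor_act_add_left tensor_act_single V1_module(2)[OF char] V1_coords_add
        V1_coords_single UNIV_module_smult um_scalar_zero)
next
  case (add f f')
  then show ?case
    by (cases "V1_coords Q f"; cases "V1_coords Q f'"; cases g)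
      (simp_all add: tensor_act_add_right V1_coords_add UNIV_module_smult add_ac)
qed (cases g, simp_all add: V1_coords_zero zero_prod_def UNIV_module_smult)

text \<open>\<open>V1_coords\<close> is bijective modulo null sums, so a decomposition of
  \<open>Q \<otimes>\<^sub>m V1\<close> reduces to a bijection on triples that satisfies explicit
  coordinate identities.\<close>

lemma tensor_V1_isoI:
  assumes D: "left_module D" and bij: "bij_betw \<theta> UNIV (carrier D)"
    and add_\<theta>: "\<And>s t. \<theta> (s + t) = \<theta> s \<oplus>\<^bsub>D\<^esub> \<theta> t"
    and scalar: "\<And>c m1 m2 m3.
      \<theta> (um_scalar c \<odot>\<^bsub>Q\<^esub> m1, um_scalar c \<odot>\<^bsub>Q\<^esub> m2, um_scalar c \<odot>\<^bsub>Q\<^esub> m3) =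
        um_scalar c \<odot>\<^bsub>D\<^esub> \<theta> (m1, m2, m3)"
    and gen: "\<And>g m1 m2 m3.
      \<theta> ((um_gen g \<odot>\<^bsub>Q\<^esub> m1, um_gen g \<odot>\<^bsub>Q\<^esub> m2, um_gen g \<odot>\<^bsub>Q\<^esub> m3) + V1_gen g (m1, m2, m3)) =
        um_gen g \<odot>\<^bsub>D\<^esub> \<theta> (m1, m2, m3)"
  shows "Q \<otimes>\<^sub>m V1 \<simeq> D"
proof (rule tensor_mod_isoI[where \<Lambda> = "\<lambda>f. \<theta> (V1_coords Q f)", OF char Q V1_module(1)[OF char] D])
  have C: "{f. Poly_Mapping.keys f \<subseteq> carrier Q \<times> carrier V1} = (UNIV :: ('v \<times> 'k \<times> 'k \<times> 'k \<Rightarrow>\<^sub>0 'k) set)"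
    by (simp add: carrier V1_def)
  have "surj (V1_coords Q)" using V1_coords_tensor by (rule surjI)
  then show "(\<lambda>f. \<theta> (V1_coords Q f)) ` {f. Poly_Mapping.keys f \<subseteq> carrier Q \<times> carrier V1} = carrier D"
    using bij unfolding C bij_betw_def by (metis image_image)
  fix f g :: "'v \<times> 'k \<times> 'k \<times> 'k \<Rightarrow>\<^sub>0 'k"
  show "\<theta> (V1_coords Q (f + g)) = \<theta> (V1_coords Q f) \<oplus>\<^bsub>D\<^esub> \<theta> (V1_coords Q g)"
    by (simp add: V1_coords_add add_\<theta>)
  have "f - g \<in> tensor_null Q V1" if "V1_coords Q f = V1_coords Q g"
  proof -
    have "f - g = (f - V1_tensor (V1_coords Q f)) - (g - V1_tensor (V1_coords Q g))"
      using that by simp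
    then show ?thesis using tensor_null.diff V1_tensor_coords by metis
  qed
  then show "\<theta> (V1_coords Q f) = \<theta> (V1_coords Q g) \<longleftrightarrow> f - g \<in> tensor_null Q V1"
    using V1_coords_null[of "f - g"] inj_eq[OF bij_betw_imp_inj_on[OF bij]] V1_coords_diff by auto
  show "\<theta> (V1_coords Q (tensor_act Q V1 (Poly_Mapping.single (1, 1) c) f)) =
      um_scalar c \<odot>\<^bsub>D\<^esub> \<theta> (V1_coords Q f)" for c
    by (cases "V1_coords Q f") (simp add: V1_coords_act_scalar scalar)
  show "\<theta> (V1_coords Q (tensor_act Q V1
      (Poly_Mapping.single (um_gen g, 1) 1 + Poly_Mapping.single (1, um_gen g) 1) f)) =
      um_gen g \<odot>\<^bsub>D\<^esub> \<theta> (V1_coords Q f)" for g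
    unfolding V1_coords_act_gen by (cases "V1_coords Q f") (simp only: map_prod_simp gen)
qed

end

section \<open>Models of the projective covers\<close>

type_synonym 'k vec8 = "'k \<times> 'k \<times> 'k \<times> 'k \<times> 'k \<times> 'k \<times> 'k \<times> 'k"

lemma vec8_cases:
  obtains x1 x2 x3 x4 x5 x6 x7 x8 where "x = (x1, x2, x3, x4, x5, x6, x7, x8)"
  by (metis surj_pair)

fun scale8 :: "'k::times \<Rightarrow> 'k vec8 \<Rightarrow> 'k vec8" where
  "scale8 c (x1, x2, x3, x4, x5, x6, x7, x8) =
    (c * x1, c * x2, c * x3, c * x4, c * x5, c * x6, c * x7, c * x8)"

text \<open>
  In the basis \<open>q, a q, b q, a\<^sup>2 q, b a q, b\<^sup>2 q, a\<^sup>3 q, b\<^sup>3 q\<close>, with \<open>c q = a b a q = b\<^sup>2 a q = 0\<close>.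
\<close>

fun P0_gen :: "gen \<Rightarrow> 'k::{zero,plus} vec8 \<Rightarrow> 'k vec8" where
  "P0_gen GenA (x1, x2, x3, x4, x5, x6, x7, x8) = (0, x1, x6, x2, x3, x8, x4, 0)"
| "P0_gen GenB (x1, x2, x3, x4, x5, x6, x7, x8) = (0, x4, x1, x7, x2, x3, 0, x6)"
| "P0_gen GenC (x1, x2, x3, x4, x5, x6, x7, x8) = (0, x2, x3, 0, 0, 0, x7, x8)"

text \<open>
  In the basis \<open>q, b q, b\<^sup>2 q, b\<^sup>3 q, a q, b a q, b\<^sup>2 a q, b\<^sup>3 a q\<close>, with \<open>c q = q\<close> and \<open>a\<^sup>2 q = 0\<close>.
\<close>

fun P1_gen :: "gen \<Rightarrow> 'k::{zero,plus} vec8 \<Rightarrow> 'k vec8" where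
  "P1_gen GenA (x1, x2, x3, x4, x5, x6, x7, x8) = (x2, x3, 0, 0, x1, x2 + x7, x3 + x8, x4)"
| "P1_gen GenB (x1, x2, x3, x4, x5, x6, x7, x8) = (0, x1, x2, x3, 0, x5, x6, x7)"
| "P1_gen GenC (x1, x2, x3, x4, x5, x6, x7, x8) = (x1, 0, x3, 0, 0, x6, 0, x8)"

abbreviation P0_model :: "('k::field um, 'k vec8) module" where
  "P0_model \<equiv> gen_module scale8 P0_gen"

abbreviation P1_model :: "('k::field um, 'k vec8) module" where
  "P1_model \<equiv> gen_module scale8 P1_gen"

lemma vector_space_scale8: "vector_space (scale8 :: 'k::field \<Rightarrow> _)"
  by standard (auto simp: algebra_simps)

text \<open>The entries follow from the relations of q: c multiplies a basis word by the parity of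
  its length, and for instance b a a q = a b a q + c a q = a q.\<close>

lemma P0_model_props:
  assumes char: "CHAR('k::field) = 2"
  shows "left_module (P0_model :: ('k um, 'k vec8) module)"
    and "um_gen g \<odot>\<^bsub>P0_model\<^esub> v = P0_gen g (v :: 'k vec8)"
    and "um_scalar c \<odot>\<^bsub>P0_model\<^esub> v = scale8 c (v :: 'k vec8)"
proof -
  have lin: "P0_gen g (x + y) = P0_gen g x + P0_gen g y" "P0_gen g (scale8 d x) = scale8 d (P0_gen g x)"
    for g d and x y :: "'k vec8"
    by (cases g; cases x rule: vec8_cases; cases y rule: vec8_cases; simp add: add_ac distrib_left)+
  have rels: "P0_gen GenA (P0_gen GenB v) + P0_gen GenB (P0_gen GenA v) = P0_gen GenC v"
    "P0_gen GenA (P0_gen GenC v) + P0_gen GenC (P0_gen GenA v) = P0_gen GenA v"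
    "P0_gen GenB (P0_gen GenC v) + P0_gen GenC (P0_gen GenB v) = P0_gen GenB v"
    "P0_gen GenA (P0_gen GenA (P0_gen GenA (P0_gen GenA v))) = 0"
    "P0_gen GenB (P0_gen GenB (P0_gen GenB (P0_gen GenB v))) = 0"
    "P0_gen GenC (P0_gen GenC v) + P0_gen GenC v = 0" for v :: "'k vec8"
    by (cases v rule: vec8_cases; simp add: double_eq_zero[OF char] zero_prod_def add_ac)+
  note props = gen_module_props[where \<rho> = P0_gen, OF vector_space_scale8 lin rels]
  show "left_module (P0_model :: ('k um, 'k vec8) module)" by (rule props(1))
  show "um_gen g \<odot>\<^bsub>P0_model\<^esub> v = P0_gen g v" by (rule props(2))
  show "um_scalar c \<odot>\<^bsub>P0_model\<^esub> v = scale8 c v" by (rule props(3))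
qed

text \<open>Here c multiplies a basis word by the parity of its length plus one, and a is moved
  right by a b = b a + c; for instance a b q = b a q + q.\<close>

lemma P1_model_props:
  assumes char: "CHAR('k::field) = 2"
  shows "left_module (P1_model :: ('k um, 'k vec8) module)"
    and "um_gen g \<odot>\<^bsub>P1_model\<^esub> v = P1_gen g (v :: 'k vec8)"
    and "um_scalar c \<odot>\<^bsub>P1_model\<^esub> v = scale8 c (v :: 'k vec8)"
proof -
  have lin: "P1_gen g (x + y) = P1_gen g x + P1_gen g y" "P1_gen g (scale8 d x) = scale8 d (P1_gen g x)"
    for g d and x y :: "'k vec8"
    by (cases g; cases x rule: vec8_cases; cases y rule: vec8_cases; simp add: add_ac distrib_left)+
  have rels: "P1_gen GenA (P1_gen GenB v) + P1_gen GenB (P1_gen GenA v) = P1_gen GenC v"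
    "P1_gen GenA (P1_gen GenC v) + P1_gen GenC (P1_gen GenA v) = P1_gen GenA v"
    "P1_gen GenB (P1_gen GenC v) + P1_gen GenC (P1_gen GenB v) = P1_gen GenB v"
    "P1_gen GenA (P1_gen GenA (P1_gen GenA (P1_gen GenA v))) = 0"
    "P1_gen GenB (P1_gen GenB (P1_gen GenB (P1_gen GenB v))) = 0"
    "P1_gen GenC (P1_gen GenC v) + P1_gen GenC v = 0" for v :: "'k vec8"
    by (cases v rule: vec8_cases; simp add: double_eq_zero[OF char] zero_prod_def add_ac)+
  note props = gen_module_props[where \<rho> = P1_gen, OF vector_space_scale8 lin rels]
  show "left_module (P1_model :: ('k um, 'k vec8) module)" by (rule props(1))
  show "um_gen g \<odot>\<^bsub>P1_model\<^esub> v = P1_gen g v" by (rule props(2))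
  show "um_scalar c \<odot>\<^bsub>P1_model\<^esub> v = scale8 c v" by (rule props(3))
qed

section \<open>The models as left ideals of u(m)\<close>

abbreviation ua :: "'k::field um" where "ua \<equiv> um_gen GenA"
abbreviation ub :: "'k::field um" where "ub \<equiv> um_gen GenB"
abbreviation uc :: "'k::field um" where "uc \<equiv> um_gen GenC"

text \<open>Idempotents that generate copies of the two models as left ideals of \<open>u(m)\<close>.\<close>

definition idem0 :: "'k::field um" where
  "idem0 = (1 + ua * ub + ua * ua * ub * ub) * (1 + uc)"

definition idem1 :: "'k::field um" where
  "idem1 = ua * ua * ub * ub * uc"

fun P0_to_um :: "'k::field vec8 \<Rightarrow> 'k um" where
  "P0_to_um (x1, x2, x3, x4, x5, x6, x7, x8) =
    um_scalar x1 * idem0 + um_scalar x2 * (ua * idem0) + um_scalar x3 * (ub * idem0)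
      + um_scalar x4 * (ua * (ua * idem0)) + um_scalar x5 * (ub * (ua * idem0)) + um_scalar x6 * (ub * (ub * idem0))
      + um_scalar x7 * (ua * (ua * (ua * idem0))) + um_scalar x8 * (ub * (ub * (ub * idem0)))"

fun P1_to_um :: "'k::field vec8 \<Rightarrow> 'k um" where
  "P1_to_um (x1, x2, x3, x4, x5, x6, x7, x8) =
    um_scalar x1 * idem1 + um_scalar x2 * (ub * idem1) + um_scalar x3 * (ub * (ub * idem1))
      + um_scalar x4 * (ub * (ub * (ub * idem1))) + um_scalar x5 * (ua * idem1) + um_scalar x6 * (ub * (ua * idem1))
      + um_scalar x7 * (ub * (ub * (ua * idem1))) + um_scalar x8 * (ub * (ub * (ub * (ua * idem1))))"

lemma um_double_eq_zero:
  assumes "CHAR('k::field) = 2"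
  shows "(x :: 'k um) + x = 0" "x + (x + y) = y"
proof -
  have "(1 :: 'k) + 1 = 0"
    using double_eq_zero(1)[OF assms] .
  then have "(1 :: 'k um) + 1 = 0"
    by (metis um_scalar_add um_scalar_one um_scalar_zero)
  then show *: "x + x = 0" for x :: "'k um"
    by (metis distrib_right mult_1 mult_zero_left)
  show "x + (x + y) = y"
    by (simp add: add.assoc[symmetric] *)
qed

text \<open>Without signs in characteristic 2, the relations become rules that put letters in the
  order a, b, c. The primed version adds a trailing factor, for products nested to the
  right.\<close>

lemma um_rewrites:
  assumes char: "CHAR('k::field) = 2"
  shows "(ub :: 'k um) * ua = ua * ub + uc" "(uc :: 'k um) * ua = ua * uc + ua" "(uc :: 'k um) * ub = ub * uc + ub" "(uc :: 'k um) * uc = uc"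
    "(ua :: 'k um) * (ua * (ua * ua)) = 0" "(ub :: 'k um) * (ub * (ub * ub)) = 0"
proof -
  note rels = um_gen_relations[where 'k = 'k]
  have move: "y = x + z" if "x + y = z" for x y z :: "'k um"
    using that um_double_eq_zero[OF char] by metis
  show "(ub :: 'k um) * ua = ua * ub + uc" using rels(1) by (rule move)
  show "(uc :: 'k um) * ua = ua * uc + ua" using rels(2) by (rule move)
  show "(uc :: 'k um) * ub = ub * uc + ub" using rels(3) by (rule move)
  show "(uc :: 'k um) * uc = uc" using rels(6) move[of "uc * uc" uc 0] by (simp add: power2_eq_square)
  show "(ua :: 'k um) * (ua * (ua * ua)) = 0" using rels(4) by (simp add: power4_eq_xxxx mult.assoc)
  show "(ub :: 'k um) * (ub * (ub * ub)) = 0" using rels(5) by (simp add: power4_eq_xxxx mult.assoc)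
qed

lemma um_rewrites':
  fixes x :: "'k::field um"
  assumes char: "CHAR('k) = 2"
  shows "ub * (ua * x) = ua * (ub * x) + uc * x" "uc * (ua * x) = ua * (uc * x) + ua * x"
    "uc * (ub * x) = ub * (uc * x) + ub * x" "uc * (uc * x) = uc * x"
    "ua * (ua * (ua * (ua * x))) = 0" "ub * (ub * (ub * (ub * x))) = 0"
proof -
  note rw = um_rewrites[OF char]
  show "ub * (ua * x) = ua * (ub * x) + uc * x" "uc * (ua * x) = ua * (uc * x) + ua * x"
    "uc * (ub * x) = ub * (uc * x) + ub * x" "uc * (uc * x) = uc * x"
    unfolding mult.assoc[symmetric] rw distrib_right by rule+
  show "ua * (ua * (ua * (ua * x))) = 0" "ub * (ub * (ub * (ub * x))) = 0"
    using arg_cong[where f = "\<lambda>y. y * x", OF rw(5)] arg_cong[where f = "\<lambda>y. y * x", OF rw(6)]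
    by (simp_all add: mult.assoc)
qed

text \<open>\<open>idem0\<close> satisfies the relations imposed on q. Only \<open>ce\<close>,
  \<open>abae\<close> and \<open>bbae\<close> expand its formula; the other products follow from
  these three by commuting letters.\<close>

lemma P0_to_um_hom:
  assumes char: "CHAR('k::field) = 2"
  shows "P0_to_um \<in> mod_hom (P0_model :: ('k um, 'k vec8) module) regular"
proof -
  note rw = um_rewrites[OF char] um_rewrites'[OF char]
  note dbl = um_double_eq_zero[OF char]
  let ?e = "idem0 :: 'k um"
  have ce: "uc * ?e = 0" and abae: "ua * (ub * (ua * ?e)) = 0" and bbae: "ub * (ub * (ua * ?e)) = 0"
    by (simp_all add: idem0_def distrib_left distrib_right mult.assoc rw dbl add_ac)
  \<comment> \<open>\<open>ab\<close> is oriented against \<open>rw(7)\<close>: in the mixed basis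
    words of the models b stands to the left of a.\<close>
  have ac: "uc * (ua * x) = ua * (uc * x) + ua * x" and bc: "uc * (ub * x) = ub * (uc * x) + ub * x"
    and ab: "ua * (ub * x) = ub * (ua * x) + uc * x" for x :: "'k um"
    using rw(8,9) by (simp_all add: rw(7) add_ac dbl)
  have baae: "ub * (ua * (ua * ?e)) = ua * ?e"
    by (subst rw(7)) (simp add: abae ac ce)
  have baaae: "ub * (ua * (ua * (ua * ?e))) = ua * (ua * ?e)"
    by (subst rw(7)) (simp add: baae ac ce dbl)
  have abbe: "ua * (ub * (ub * ?e)) = ub * ?e" and abbbe: "ua * (ub * (ub * (ub * ?e))) = ub * (ub * ?e)"
    by (simp_all add: ab bbae bc ce dbl)
  have abe: "ua * (ub * ?e) = ub * (ua * ?e)"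
    by (simp add: ab ce)
  have scalar: "um_gen g * (um_scalar d * x) = um_scalar d * (um_gen g * x)" for g d and x :: "'k um"
    by (metis mult.assoc um_scalar_central)
  show ?thesis
  proof (rule mod_hom_gensI[OF P0_model_props(1)[OF char] left_module_regular])
    fix v :: "'k vec8"
    show "P0_to_um (um_scalar d \<odot>\<^bsub>P0_model\<^esub> v) = um_scalar d \<odot>\<^bsub>regular\<^esub> P0_to_um v" for d
      by (cases v rule: vec8_cases)
        (simp add: P0_model_props[OF char] um_scalar_mult distrib_left mult.assoc)
    show "P0_to_um (um_gen g \<odot>\<^bsub>P0_model\<^esub> v) = um_gen g \<odot>\<^bsub>regular\<^esub> P0_to_um v" for g
      by (cases v rule: vec8_cases; cases g)
        (simp_all add: P0_model_props[OF char] um_scalar_zero distrib_left scalar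
          ce abae bbae baae baaae abbe abbbe abe rw(5,6) rw(11,12) ac bc dbl add_ac)
    fix w :: "'k vec8"
    show "P0_to_um (v \<oplus>\<^bsub>P0_model\<^esub> w) = P0_to_um v \<oplus>\<^bsub>regular\<^esub> P0_to_um w"
      by (cases v rule: vec8_cases; cases w rule: vec8_cases)
        (simp add: um_scalar_add distrib_right add_ac)
  qed simp
qed

lemma P1_to_um_hom:
  assumes char: "CHAR('k::field) = 2"
  shows "P1_to_um \<in> mod_hom (P1_model :: ('k um, 'k vec8) module) regular"
proof -
  note rw = um_rewrites[OF char] um_rewrites'[OF char]
  note dbl = um_double_eq_zero[OF char]
  let ?e = "idem1 :: 'k um"
  have ce: "uc * ?e = ?e" and aae: "ua * (ua * ?e) = 0"
    by (simp_all add: idem1_def distrib_left distrib_right mult.assoc rw dbl add_ac)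
  have ac: "uc * (ua * x) = ua * (uc * x) + ua * x" and bc: "uc * (ub * x) = ub * (uc * x) + ub * x"
    and ab: "ua * (ub * x) = ub * (ua * x) + uc * x" for x :: "'k um"
    using rw(8,9) by (simp_all add: rw(7) add_ac dbl)
  have scalar: "um_gen g * (um_scalar d * x) = um_scalar d * (um_gen g * x)" for g d and x :: "'k um"
    by (metis mult.assoc um_scalar_central)
  show ?thesis
  proof (rule mod_hom_gensI[OF P1_model_props(1)[OF char] left_module_regular])
    fix v :: "'k vec8"
    show "P1_to_um (um_scalar d \<odot>\<^bsub>P1_model\<^esub> v) = um_scalar d \<odot>\<^bsub>regular\<^esub> P1_to_um v" for d
      by (cases v rule: vec8_cases)
        (simp add: P1_model_props[OF char] um_scalar_mult distrib_left mult.assoc)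
    show "P1_to_um (um_gen g \<odot>\<^bsub>P1_model\<^esub> v) = um_gen g \<odot>\<^bsub>regular\<^esub> P1_to_um v" for g
      by (cases v rule: vec8_cases; cases g)
        (simp_all add: P1_model_props[OF char] um_scalar_zero um_scalar_add distrib_left
          distrib_right scalar ce aae rw(5,6) rw(11,12) ab ac bc dbl add_ac)
    fix w :: "'k vec8"
    show "P1_to_um (v \<oplus>\<^bsub>P1_model\<^esub> w) = P1_to_um v \<oplus>\<^bsub>regular\<^esub> P1_to_um w"
      by (cases v rule: vec8_cases; cases w rule: vec8_cases)
        (simp add: um_scalar_add distrib_right add_ac)
  qed simp
qed

section \<open>Identification of the given covers with the models\<close>

lemma P0_model_smult:
  assumes char: "CHAR('k::field) = 2"
  shows "(x + y) \<odot>\<^bsub>P0_model\<^esub> v = x \<odot>\<^bsub>P0_model\<^esub> v + y \<odot>\<^bsub>P0_model\<^esub> (v :: 'k vec8)"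
    "(x * y) \<odot>\<^bsub>P0_model\<^esub> v = x \<odot>\<^bsub>P0_model\<^esub> (y \<odot>\<^bsub>P0_model\<^esub> v)" "1 \<odot>\<^bsub>P0_model\<^esub> v = v"
  by (rule UNIV_module_smult[OF char P0_model_props(1)[OF char] gen_module_simps(1,3)])+

lemma P1_model_smult:
  assumes char: "CHAR('k::field) = 2"
  shows "(x + y) \<odot>\<^bsub>P1_model\<^esub> v = x \<odot>\<^bsub>P1_model\<^esub> v + y \<odot>\<^bsub>P1_model\<^esub> (v :: 'k vec8)"
    "(x * y) \<odot>\<^bsub>P1_model\<^esub> v = x \<odot>\<^bsub>P1_model\<^esub> (y \<odot>\<^bsub>P1_model\<^esub> v)" "1 \<odot>\<^bsub>P1_model\<^esub> v = v"
  by (rule UNIV_module_smult[OF char P1_model_props(1)[OF char] gen_module_simps(1,3)])+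

lemma um_scalar_smult_V0: "um_scalar c \<odot>\<^bsub>V0\<^esub> (v :: 'k) = (c :: 'k::field) * v"
proof -
  have "vector_space ((*) :: 'k \<Rightarrow> 'k \<Rightarrow> 'k)"
    by standard (simp_all add: algebra_simps)
  then show ?thesis
    unfolding V0_def by (rule gen_module_props(3)[where \<rho> = "\<lambda>_ _. 0"]) simp_all
qed

lemma P0_mod_iso_model:
  fixes P0 :: "('k::field um, 'p) module"
  assumes char: "CHAR('k) = 2" and cover: "projective_cover P0 V0"
  shows "P0 \<simeq> (P0_model :: ('k um, 'k vec8) module)"
proof -
  let ?Q = "P0_model :: ('k um, 'k vec8) module"
  let ?q = "(1, 0, 0, 0, 0, 0, 0, 0) :: 'k vec8"
  have two: "(2 :: 'k) = 0"
    using double_eq_zero(1)[OF char, of 1] by simp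
  note Q = P0_model_props(1)[OF char]
  note smult = P0_model_props(2,3)[OF char] P0_model_smult[OF char] double_eq_zero[OF char] two
  \<comment> \<open>Once \<open>idem0\<close> fixes q, the words in \<open>P0_to_um\<close> evaluate
    at q to the basis vectors, so r \<mapsto> r q is a left inverse of
    \<open>P0_to_um\<close>.\<close>
  have idem: "idem0 \<odot>\<^bsub>?Q\<^esub> ?q = ?q"
    by (simp add: idem0_def smult)
  have repr: "P0_to_um v \<odot>\<^bsub>?Q\<^esub> ?q = v" for v
    by (cases v rule: vec8_cases) (simp add: smult idem)
  have \<pi>: "fst \<in> mod_hom ?Q V0"
  proof (rule mod_hom_gensI[OF Q V0_module(1)])
    fix v w :: "'k vec8"
    show "fst (v \<oplus>\<^bsub>?Q\<^esub> w) = fst v \<oplus>\<^bsub>V0\<^esub> fst w"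
      by (simp add: V0_def)
    show "fst (um_scalar d \<odot>\<^bsub>?Q\<^esub> v) = um_scalar d \<odot>\<^bsub>V0\<^esub> fst v" for d
      by (cases v rule: vec8_cases) (simp add: um_scalar_smult_V0 smult)
    show "fst (um_gen g \<odot>\<^bsub>?Q\<^esub> v) = um_gen g \<odot>\<^bsub>V0\<^esub> fst v" for g
      by (cases v rule: vec8_cases; cases g) (simp_all add: V0_module(2) smult)
  qed (simp add: V0_def)
  show ?thesis
  proof (rule projective_cover_unique[OF cover Q V0_module(1) P0_to_um_hom[OF char] _ repr \<pi>])
    show "fst ` carrier ?Q = carrier V0"
      by (auto simp: V0_def)
    show "superfluous {x \<in> carrier ?Q. fst x = \<zero>\<^bsub>V0\<^esub>} ?Q"
    proof (rule superfluous_kernelI[OF Q V0_module(1) \<pi>])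
      show "\<exists>r. r \<odot>\<^bsub>?Q\<^esub> ?q = x" for x using repr by blast
      fix u :: "'k vec8" assume "fst u = fst ?q"
      then obtain x2 x3 x4 x5 x6 x7 x8 where u: "u = (1, x2, x3, x4, x5, x6, x7, x8)"
        by (cases u rule: vec8_cases) auto
      \<comment> \<open>\<open>1 + uc\<close> deletes coordinates 2, 3, 7, 8, on which c acts as 1;
        the next factor kills a^2 q and b^2 q and fixes q and b a q. The last one turns q + x5 b a q
        into q, as b a b a q = 0.\<close>
      have "((1 + um_scalar x5 * ub * ua) * ((1 + ua * ub + ua * ua * ub * ub) * (1 + uc))) \<odot>\<^bsub>?Q\<^esub> u = ?q"
        by (simp add: u smult add_ac)
      then show "\<exists>r. r \<odot>\<^bsub>?Q\<^esub> u = ?q" by blast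
    qed simp
  qed simp
qed

lemma P1_mod_iso_model:
  fixes P1 :: "('k::field um, 'p) module"
  assumes char: "CHAR('k) = 2" and cover: "projective_cover P1 V1"
  shows "P1 \<simeq> (P1_model :: ('k um, 'k vec8) module)"
proof -
  let ?Q = "P1_model :: ('k um, 'k vec8) module"
  let ?q = "(1, 0, 0, 0, 0, 0, 0, 0) :: 'k vec8"
  \<comment> \<open>q goes to v_3, which is fixed by c and killed by a; hence b q and b^2 q go to
    v_2 and v_1, and the order of coordinates is reversed.\<close>
  let ?\<pi> = "(\<lambda>(x1, x2, x3, x4, x5, x6, x7, x8). (x3, x2, x1)) :: 'k vec8 \<Rightarrow> 'k \<times> 'k \<times> 'k"
  have two: "(2 :: 'k) = 0"
    using double_eq_zero(1)[OF char, of 1] by simp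
  note Q = P1_model_props(1)[OF char] and V1 = V1_module(1)[OF char]
  note smult = P1_model_props(2,3)[OF char] P1_model_smult[OF char] double_eq_zero[OF char] two
  have idem: "idem1 \<odot>\<^bsub>?Q\<^esub> ?q = ?q"
    by (simp add: idem1_def smult)
  have repr: "P1_to_um v \<odot>\<^bsub>?Q\<^esub> ?q = v" for v
    by (cases v rule: vec8_cases) (simp add: smult idem)
  have \<pi>: "?\<pi> \<in> mod_hom ?Q V1"
  proof (rule mod_hom_gensI[OF Q V1])
    fix v w :: "'k vec8"
    show "?\<pi> (v \<oplus>\<^bsub>?Q\<^esub> w) = ?\<pi> v \<oplus>\<^bsub>V1\<^esub> ?\<pi> w"
      by (cases v rule: vec8_cases; cases w rule: vec8_cases) (simp add: V1_def)
    show "?\<pi> (um_scalar d \<odot>\<^bsub>?Q\<^esub> v) = um_scalar d \<odot>\<^bsub>V1\<^esub> ?\<pi> v" for d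
      by (cases v rule: vec8_cases) (simp add: um_scalar_smult_V1[OF char] smult)
    show "?\<pi> (um_gen g \<odot>\<^bsub>?Q\<^esub> v) = um_gen g \<odot>\<^bsub>V1\<^esub> ?\<pi> v" for g
      by (cases v rule: vec8_cases; cases g) (simp_all add: V1_module(2)[OF char] smult)
  qed (simp add: V1_def)
  show ?thesis
  proof (rule projective_cover_unique[OF cover Q V1 P1_to_um_hom[OF char] _ repr \<pi>])
    have "surj ?\<pi>"
      by (rule surjI[where f = "\<lambda>t. (snd (snd t), fst (snd t), fst t, 0, 0, 0, 0, 0) :: 'k vec8"]) simp
    then show "?\<pi> ` carrier ?Q = carrier V1"
      by (simp add: V1_def)
    show "superfluous {x \<in> carrier ?Q. ?\<pi> x = \<zero>\<^bsub>V1\<^esub>} ?Q"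
    proof (rule superfluous_kernelI[OF Q V1 \<pi>])
      show "\<exists>r. r \<odot>\<^bsub>?Q\<^esub> ?q = x" for x using repr by blast
      fix u :: "'k vec8" assume "?\<pi> u = ?\<pi> ?q"
      then obtain x4 x5 x6 x7 x8 where u: "u = (1, 0, 0, x4, x5, x6, x7, x8)"
        by (cases u rule: vec8_cases) auto
      \<comment> \<open>c keeps coordinates 1, 6, 8; a^2 b^2 kills b^3 a q and fixes q and b a q.
        The remaining x6 b a q is removed since a b a q = 0.\<close>
      have "((1 + um_scalar x6 * ub * ua) * (ua * ua * ub * ub * uc)) \<odot>\<^bsub>?Q\<^esub> u = ?q"
        by (simp add: u smult add_ac)
      then show "\<exists>r. r \<odot>\<^bsub>?Q\<^esub> u = ?q" by blast
    qed simp
  qed simp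
qed

section \<open>Decomposition of the tensor products\<close>

text \<open>
  The inverse map \<open>P0_V1_join\<close> takes the three generators of \<open>3 P\<^sub>1\<close> to \<open>b q \<otimes> v\<^sub>2\<close>, \<open>a\<^sup>3 q \<otimes> v\<^sub>2\<close>
  and \<open>a\<^sup>2 q \<otimes> v\<^sub>1 + q \<otimes> v\<^sub>3\<close>.
\<close>

fun P0_V1_split :: "'k::{zero,plus} vec8 \<times> 'k vec8 \<times> 'k vec8 \<Rightarrow> 'k vec8 \<times> 'k vec8 \<times> 'k vec8" where
  "P0_V1_split ((x1, x2, x3, x4, x5, x6, x7, x8),
      (y1, y2, y3, y4, y5, y6, y7, y8),
      (z1, z2, z3, z4, z5, z6, z7, z8)) =
      ((x1 + y3 + z6, x3 + z8, x6 + y8, x8, y1 + z3, x1 + z6, x3 + y6, x6),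
      (y7 + z4, x7 + z2, x4 + y2 + z1, x2 + y1, z7, z4, x7 + y4, x4 + z1),
      (z1, y1, x1, x3 + y6 + z8, x7 + y4 + z2, x4 + z1 + z5, x2 + y5 + z3, x5 + z6))"

fun P0_V1_join :: "'k::{zero,plus} vec8 \<times> 'k vec8 \<times> 'k vec8 \<Rightarrow> 'k vec8 \<times> 'k vec8 \<times> 'k vec8" where
  "P0_V1_join ((x1, x2, x3, x4, x5, x6, x7, x8),
      (y1, y2, y3, y4, y5, y6, y7, y8),
      (z1, z2, z3, z4, z5, z6, z7, z8)) =
      ((z3, y4 + z2, x2 + x7 + z4, y8 + z1, x6 + z3 + z8, x8, y2 + y7 + z5, x4),
      (z2, y3 + y8, x1 + x6, y2 + z5, x5 + y4 + z7, x2 + z4, y1 + y6, x3 + x8),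
      (z1, y7 + z5, x5 + z2, y6, y8 + z6, x6 + z3, y5, x7 + z4))"

text \<open>For each of the three generators w, every summand pairs c-eigenvalues of sum 1, so c w =
  w; and a^2 w = 0, because a^2 is again primitive in characteristic 2. Applying the basis words of
  the model to them gives the columns of \<open>P0_V1_join\<close>.\<close>

lemma P0_model_tensor_V1:
  assumes char: "CHAR('k::field) = 2"
  shows "(P0_model :: ('k um, 'k vec8) module) \<otimes>\<^sub>m V1 \<simeq> P1_model \<oplus>\<^sub>d P1_model \<oplus>\<^sub>d P1_model"
proof (rule tensor_V1_isoI[where \<theta> = P0_V1_split, OF char _ gen_module_simps(1,3)])
  note props = P0_model_props[OF char] P1_model_props[OF char]
  show "left_module (P0_model :: ('k um, 'k vec8) module)"
    "left_module (P1_model \<oplus>\<^sub>d P1_model \<oplus>\<^sub>d P1_model :: ('k um, 'k vec8 \<times> 'k vec8 \<times> 'k vec8) module)"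
    by (intro left_module_direct_sum props)+
  show "bij_betw P0_V1_split UNIV (carrier (P1_model \<oplus>\<^sub>d P1_model \<oplus>\<^sub>d P1_model :: ('k um, 'k vec8 \<times> 'k vec8 \<times> 'k vec8) module))"
  proof (rule bij_betw_byWitness[where f' = P0_V1_join])
    show "\<forall>t\<in>UNIV. P0_V1_join (P0_V1_split t) = (t :: 'k vec8 \<times> 'k vec8 \<times> 'k vec8)"
      by (intro ballI, case_tac t rule: P0_V1_split.cases) (simp add: add_ac double_eq_zero[OF char])
    show "\<forall>t\<in>carrier (P1_model \<oplus>\<^sub>d P1_model \<oplus>\<^sub>d P1_model). P0_V1_split (P0_V1_join t) = (t :: 'k vec8 \<times> 'k vec8 \<times> 'k vec8)"
      by (intro ballI, case_tac t rule: P0_V1_split.cases) (simp add: add_ac double_eq_zero[OF char])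
  qed auto
  show "P0_V1_split (s + t) = P0_V1_split s \<oplus>\<^bsub>P1_model \<oplus>\<^sub>d P1_model \<oplus>\<^sub>d P1_model\<^esub> P0_V1_split t" for s t :: "'k vec8 \<times> 'k vec8 \<times> 'k vec8"
    by (cases s rule: P0_V1_split.cases; cases t rule: P0_V1_split.cases) (simp add: add_ac)
  fix m1 m2 m3 :: "'k vec8"
  show "P0_V1_split (um_scalar c \<odot>\<^bsub>P0_model\<^esub> m1, um_scalar c \<odot>\<^bsub>P0_model\<^esub> m2, um_scalar c \<odot>\<^bsub>P0_model\<^esub> m3) =
      um_scalar c \<odot>\<^bsub>P1_model \<oplus>\<^sub>d P1_model \<oplus>\<^sub>d P1_model\<^esub> P0_V1_split (m1, m2, m3)" for c
    by (cases m1 rule: vec8_cases; cases m2 rule: vec8_cases; cases m3 rule: vec8_cases) (simp add: props distrib_left)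
  show "P0_V1_split ((um_gen g \<odot>\<^bsub>P0_model\<^esub> m1, um_gen g \<odot>\<^bsub>P0_model\<^esub> m2, um_gen g \<odot>\<^bsub>P0_model\<^esub> m3)
      + V1_gen g (m1, m2, m3)) = um_gen g \<odot>\<^bsub>P1_model \<oplus>\<^sub>d P1_model \<oplus>\<^sub>d P1_model\<^esub> P0_V1_split (m1, m2, m3)" for g
    by (cases m1 rule: vec8_cases; cases m2 rule: vec8_cases; cases m3 rule: vec8_cases; cases g)
      (simp_all add: props zero_prod_def add_ac double_eq_zero[OF char])
qed

text \<open>
  \<open>P1_V1_join\<close> takes the generator of \<open>P\<^sub>0\<close> to
  \<open>q \<otimes> v\<^sub>1 + b a q \<otimes> v\<^sub>1 + b q \<otimes> v\<^sub>2 + b\<^sup>2 q \<otimes> v\<^sub>3\<close>, and those of \<open>2 P\<^sub>1\<close> to \<open>q \<otimes> v\<^sub>2\<close> and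
  \<open>b a q \<otimes> v\<^sub>2\<close>.
\<close>

fun P1_V1_split :: "'k::{zero,plus} vec8 \<times> 'k vec8 \<times> 'k vec8 \<Rightarrow> 'k vec8 \<times> 'k vec8 \<times> 'k vec8" where
  "P1_V1_split ((x1, x2, x3, x4, x5, x6, x7, x8),
      (y1, y2, y3, y4, y5, y6, y7, y8),
      (z1, z2, z3, z4, z5, z6, z7, z8)) =
      ((x1 + y2 + z3, x5 + z2, x2 + z4, y5 + z1, x6 + y7 + z3 + z8, x3 + y4, z5, x4),
      (y1 + z2, x1 + z3, x2 + y3, x3, z1, z2, x1 + y2, x2),
      (x5 + y6 + z7, x1 + x6 + y2 + z3 + z8, x2 + x7 + y8 + z4, x3 + x8 + y4, y5 + z1 + z6, x5 + z2 + z7, x6 + y7 + z3, x7 + z4))"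

fun P1_V1_join :: "'k::{zero,plus} vec8 \<times> 'k vec8 \<times> 'k vec8 \<Rightarrow> 'k vec8 \<times> 'k vec8 \<times> 'k vec8" where
  "P1_V1_join ((x1, x2, x3, x4, x5, x6, x7, x8),
      (y1, y2, y3, y4, y5, y6, y7, y8),
      (z1, z2, z3, z4, z5, z6, z7, z8)) =
      ((x1 + y2 + y7, y8, y4, x8, x2 + y6, x1 + x5 + z2 + z7, x3 + y8 + z8, x6 + z4),
      (y1 + y6, x1 + y2, y3 + y8, x6 + y4, x4 + y5, y6 + z1 + z6, x5 + y7 + z2, y8 + z3 + z8),
      (y5, y6, x1 + y7, x3 + y8, x7, x4 + z5, x2 + z6, x5 + z7))"

text \<open>The generator w of the copy of P_0 pairs equal c-eigenvalues, so c w = 0. Its summand b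
  a q \<otimes> v_1 makes a w collapse to a q \<otimes> v_1 + b^2 a q \<otimes> v_3, which both a b
  and b^2 kill.\<close>

lemma P1_model_tensor_V1:
  assumes char: "CHAR('k::field) = 2"
  shows "(P1_model :: ('k um, 'k vec8) module) \<otimes>\<^sub>m V1 \<simeq> P0_model \<oplus>\<^sub>d P1_model \<oplus>\<^sub>d P1_model"
proof (rule tensor_V1_isoI[where \<theta> = P1_V1_split, OF char _ gen_module_simps(1,3)])
  note props = P0_model_props[OF char] P1_model_props[OF char]
  show "left_module (P1_model :: ('k um, 'k vec8) module)"
    "left_module (P0_model \<oplus>\<^sub>d P1_model \<oplus>\<^sub>d P1_model :: ('k um, 'k vec8 \<times> 'k vec8 \<times> 'k vec8) module)"
    by (intro left_module_direct_sum props)+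
  show "bij_betw P1_V1_split UNIV (carrier (P0_model \<oplus>\<^sub>d P1_model \<oplus>\<^sub>d P1_model :: ('k um, 'k vec8 \<times> 'k vec8 \<times> 'k vec8) module))"
  proof (rule bij_betw_byWitness[where f' = P1_V1_join])
    show "\<forall>t\<in>UNIV. P1_V1_join (P1_V1_split t) = (t :: 'k vec8 \<times> 'k vec8 \<times> 'k vec8)"
      by (intro ballI, case_tac t rule: P1_V1_split.cases) (simp add: add_ac double_eq_zero[OF char])
    show "\<forall>t\<in>carrier (P0_model \<oplus>\<^sub>d P1_model \<oplus>\<^sub>d P1_model). P1_V1_split (P1_V1_join t) = (t :: 'k vec8 \<times> 'k vec8 \<times> 'k vec8)"
      by (intro ballI, case_tac t rule: P1_V1_split.cases) (simp add: add_ac double_eq_zero[OF char])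
  qed auto
  show "P1_V1_split (s + t) = P1_V1_split s \<oplus>\<^bsub>P0_model \<oplus>\<^sub>d P1_model \<oplus>\<^sub>d P1_model\<^esub> P1_V1_split t" for s t :: "'k vec8 \<times> 'k vec8 \<times> 'k vec8"
    by (cases s rule: P1_V1_split.cases; cases t rule: P1_V1_split.cases) (simp add: add_ac)
  fix m1 m2 m3 :: "'k vec8"
  show "P1_V1_split (um_scalar c \<odot>\<^bsub>P1_model\<^esub> m1, um_scalar c \<odot>\<^bsub>P1_model\<^esub> m2, um_scalar c \<odot>\<^bsub>P1_model\<^esub> m3) =
      um_scalar c \<odot>\<^bsub>P0_model \<oplus>\<^sub>d P1_model \<oplus>\<^sub>d P1_model\<^esub> P1_V1_split (m1, m2, m3)" for c
    by (cases m1 rule: vec8_cases; cases m2 rule: vec8_cases; cases m3 rule: vec8_cases) (simp add: props distrib_left)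
  show "P1_V1_split ((um_gen g \<odot>\<^bsub>P1_model\<^esub> m1, um_gen g \<odot>\<^bsub>P1_model\<^esub> m2, um_gen g \<odot>\<^bsub>P1_model\<^esub> m3)
      + V1_gen g (m1, m2, m3)) = um_gen g \<odot>\<^bsub>P0_model \<oplus>\<^sub>d P1_model \<oplus>\<^sub>d P1_model\<^esub> P1_V1_split (m1, m2, m3)" for g
    by (cases m1 rule: vec8_cases; cases m2 rule: vec8_cases; cases m3 rule: vec8_cases; cases g)
      (simp_all add: props zero_prod_def add_ac double_eq_zero[OF char])
qed

theorem proposition4p6:
  fixes P0 :: "('k::alg_closed_field um, 'p) module"
    and P1 :: "('k um, 'q) module"
  assumes "CHAR('k) = 2"
    and "projective_cover P0 V0"
    and "projective_cover P1 V1"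
  shows "P0 \<otimes>\<^sub>m V1 \<simeq> copies 3 P1 \<and> P1 \<otimes>\<^sub>m V1 \<simeq> P0 \<oplus>\<^sub>d copies 2 P1"
proof -
  let ?Q0 = "P0_model :: ('k um, 'k vec8) module" and ?Q1 = "P1_model :: ('k um, 'k vec8) module"
  note char = assms(1)
  note Q0 = P0_model_props(1)[OF char] and Q1 = P1_model_props(1)[OF char] and V1 = V1_module(1)[OF char]
  have P0: "left_module P0" and P1: "left_module P1"
    using assms(2,3) by (simp_all add: projective_cover_def projective_def)
  note iso0 = P0_mod_iso_model[OF char assms(2)] and iso1 = P1_mod_iso_model[OF char assms(3)]
  \<comment> \<open>The covers occur on both sides: as tensor factors, replaced by the models
    through \<open>iso0\<close> and \<open>iso1\<close>, and as summands, recovered through the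
    inverses.\<close>
  note iso0' = mod_iso_sym[OF P0 iso0] and iso1' = mod_iso_sym[OF P1 iso1]
  have "?Q1 \<oplus>\<^sub>d ?Q1 \<simeq> P1 \<oplus>\<^sub>d copies 1 P1"
    by (intro direct_sum_mod_iso Q1 iso1' mod_iso_trans[OF iso1' copies_1_mod_iso])
  then have two: "?Q1 \<oplus>\<^sub>d ?Q1 \<simeq> copies 2 P1"
    using mod_iso_trans mod_iso_sym[OF left_module_copies[OF P1] copies_Suc_mod_iso[of 1 P1]] by (simp add: numeral_2_eq_2)
  have "?Q1 \<oplus>\<^sub>d ?Q1 \<oplus>\<^sub>d ?Q1 \<simeq> P1 \<oplus>\<^sub>d copies 2 P1"
    by (intro direct_sum_mod_iso left_module_direct_sum Q1 iso1' two)
  then have three: "?Q1 \<oplus>\<^sub>d ?Q1 \<oplus>\<^sub>d ?Q1 \<simeq> copies 3 P1"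
    using mod_iso_trans mod_iso_sym[OF left_module_copies[OF P1] copies_Suc_mod_iso[of 2 P1]] by (simp add: eval_nat_numeral)
  have "P0 \<otimes>\<^sub>m V1 \<simeq> copies 3 P1"
    by (rule mod_iso_trans[OF tensor_mod_iso_left[OF char P0 Q0 V1 iso0]
          mod_iso_trans[OF P0_model_tensor_V1[OF char] three]])
  moreover have "?Q0 \<oplus>\<^sub>d ?Q1 \<oplus>\<^sub>d ?Q1 \<simeq> P0 \<oplus>\<^sub>d copies 2 P1"
    by (intro direct_sum_mod_iso left_module_direct_sum Q0 Q1 iso0' two)
  then have "P1 \<otimes>\<^sub>m V1 \<simeq> P0 \<oplus>\<^sub>d copies 2 P1"
    by (rule mod_iso_trans[OF tensor_mod_iso_left[OF char P1 Q1 V1 iso1]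
          mod_iso_trans[OF P1_model_tensor_V1[OF char]]])
  ultimately show ?thesis ..
qed

end
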